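(* Let $K$ be a field with $\mathrm{char}(K)=0$ or $\mathrm{char}(K)>4$. Let $R=K[x_{\{i,j\}}\mid 1\le i<j\le 4]$ be the polynomial algebra in six variables, with $S_4$ acting by $K$-algebra automorphisms via $\sigma\cdot x_{\{i,j\}}=x_{\{\sigma(i),\sigma(j)\}}$. Let $x_1,x_2,x_3,z_1,z_2,z_3\in R$, the elements $[x^az^b]\in R$, the polynomial algebra $\mathcal{F}_1$, and the elements $\tilde J_{3,2},\tilde J_{2,3},\tilde J_{4,2},\tilde J_{3,3},\tilde J_{2,4}\in\mathcal{F}_1$ be as defined in the context. (i) The algebra $R^{S_4}$ is minimally generated by the nine elements $$[x],\ [x^2],\ [x^3],\ [z^2],\ [z^4],\ [xz^2],\ [x^2z^2],\ [xz^4],\ z_1z_2z_3.$$ (ii) Consider the surjective $K$-algebra homomorphism $\phi_1:\mathcal{F}_1\to R^{S_4}$ given by $\phi_1(S)=z_1z_2z_3$ and $\phi_1(T_{x^ay^b})=[x^az^{2b}]$ for $x^ay^b\in\{x,x^2,x^3,y,y^2,xy,x^2y,xy^2\}$. The kernel of $\phi_1$ is minimally generated (as an ideal) by the five elements $$\tilde J_{3,2},\quad\tilde J_{2,3},\quad\tilde J_{4,2},\quad\tilde J_{3,3},\quad\tilde J_{2,4}.$$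
   Context: In $R$ set $$x_1=x_{\{1,2\}}+x_{\{3,4\}},\quad x_2=x_{\{1,3\}}+x_{\{2,4\}},\quad x_3=x_{\{1,4\}}+x_{\{2,3\}},$$ $$z_1=x_{\{1,2\}}-x_{\{3,4\}},\quad z_2=x_{\{1,3\}}-x_{\{2,4\}},\quad z_3=x_{\{1,4\}}-x_{\{2,3\}},$$ and $[x^az^b]:=x_1^az_1^b+x_2^az_2^b+x_3^az_3^b$ (so $[x]=x_1+x_2+x_3$, $[z^2]=z_1^2+z_2^2+z_3^2$, $[xz^2]=x_1z_1^2+x_2z_2^2+x_3z_3^2$, etc.). $R^{S_4}$ is the subalgebra of $S_4$-invariants. $\mathcal{F}=K[T_w,S\mid w\in\{x,x^2,x^3,y,y^2,y^3,xy,x^2y,xy^2\}]$ is the commutative polynomial algebra in ten indeterminates (the subscripts $w$ are monomials in $K[x,y]$), and $\mathcal{F}_1=K[T_w,S\mid w\in\{x,x^2,x^3,y,y^2,xy,x^2y,xy^2\}]$ is its subalgebra in which the variable $T_{y^3}$ is omitted. The element $\tilde J_{i,j}\in\mathcal{F}_1$ is obtained from the element $J_{i,j}\in\mathcal{F}$ below via the substitution $$T_{y^3}\mapsto 3S^2+\tfrac32T_{y^2}T_y-\tfrac12T_y^3$$ (the other variables are unchanged), where \begin{align*} J_{3,2}&=6T_{x^2y}T_{xy}-3T_{xy^2}T_{x^2}-2T_{x^2y}T_{x}T_{y}+T_{xy^2}T_{x}^2-4T_{xy}^2T_{x}+2T_{xy}T_{x}^2T_{y}\\ &\quad-3T_{x^3}T_{y^2}+4T_{x^2}T_{x}T_{y^2}-T_{x}^3T_{y^2}+T_{x^3}T_{y}^2-T_{x^2}T_{x}T_{y}^2,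 \end{align*} \begin{align*} J_{2,3}&=6T_{xy^2}T_{xy}-3T_{x^2y}T_{y^2}-2T_{xy^2}T_{x}T_{y}+T_{x^2y}T_{y}^2-4T_{xy}^2T_{y}+2T_{xy}T_{y}^2T_{x}\\ &\quad-3T_{y^3}T_{x^2}+4T_{y^2}T_{y}T_{x^2}-T_{y}^3T_{x^2}+T_{y^3}T_{x}^2-T_{y^2}T_{y}T_{x}^2, \end{align*} \begin{align*} J_{4,2}&=6T_{x^2y}^2+T_{xy}^2T_{x^2}-3T_{xy}^2T_{x}^2-6T_{x^3}T_{xy^2}+2T_{x^2}T_{xy^2}T_{x}+4T_{x^3}T_{xy}T_{y}\\ &\quad-2T_{x^2}T_{xy}T_{x}T_{y}+2T_{xy}T_{x}^3T_{y}-4T_{x^2y}T_{x^2}T_{y}-T_{x^2}^2T_{y^2}+T_{x^2}^2T_{y}^2\\ &\quad+4T_{x^2}T_{x}^2T_{y^2}-T_{x^2}T_{x}^2T_{y}^2-T_{x}^4T_{y^2}-2T_{x^3}T_{x}T_{y^2}, \end{align*} \begin{align*} J_{3,3}&=3T_{x^2y}T_{xy^2}-T_{xy}T_{x^2}T_{y^2}+T_{xy}^3+T_{xy}T_x^2T_{y^2}-5T_{xy}^2T_xT_y-3T_{x^3}T_{y^3}\\ &\quad+2T_{xy}T_{xy^2}T_x+T_{x^2}T_xT_{y^3}-3T_{x^2}T_{xy^2}T_y+2T_{x^2y}T_{xy}T_y+3T_{x^2}T_xT_{y^2}T_y\\ &\quad+T_{x^3}T_{y^2}T_y+T_{x^2}T_{xy}T_y^2-T_x^3T_{y^2}T_y+2T_x^2T_{xy}T_y^2-T_{x^2}T_xT_y^3-3T_xT_{x^2y}T_{y^2},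 \end{align*} \begin{align*} J_{2,4}&=6T_{xy^2}^2+T_{xy}^2T_{y^2}-3T_{xy}^2T_{y}^2-6T_{y^3}T_{x^2y}+2T_{y^2}T_{x^2y}T_{y}+4T_{y^3}T_{xy}T_{x}\\ &\quad-2T_{y^2}T_{xy}T_{x}T_{y}+2T_{xy}T_{y}^3T_{x}-4T_{xy^2}T_{y^2}T_{x}-T_{y^2}^2T_{x^2}+T_{y^2}^2T_{x}^2\\ &\quad+4T_{y^2}T_{y}^2T_{x^2}-T_{y^2}T_{y}^2T_{x}^2-T_{y}^4T_{x^2}-2T_{y^3}T_{y}T_{x^2}. \end{align*} "Minimally generated" means that the listed elements generate and no proper subset of them does. *)

theory Defs
  imports
    Complex_Main
    "HOL-Library.Poly_Mapping"
    "HOL-Combinatorics.Permutations"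
begin

type_synonym ('v, 'k) mpoly = "('v \<Rightarrow>\<^sub>0 nat) \<Rightarrow>\<^sub>0 'k"

definition Const :: "'k::field \<Rightarrow> ('v, 'k) mpoly" where
  "Const c = Poly_Mapping.single 0 c"

definition Var :: "'v \<Rightarrow> ('v, 'k::field) mpoly" where
  "Var v = Poly_Mapping.single (Poly_Mapping.single v 1) 1"

definition poly_subst :: "('v \<Rightarrow> ('w, 'k) mpoly) \<Rightarrow> ('v, 'k::field) mpoly \<Rightarrow> ('w, 'k) mpoly" where
  "poly_subst f p =
     (\<Sum>m\<in>Poly_Mapping.keys p. Const (Poly_Mapping.lookup p m) *
        (\<Prod>v\<in>Poly_Mapping.keys m. f v ^ Poly_Mapping.lookup m v))"

text \<open>The map \<open>poly_subst f\<close> is the \<open>K\<close>-algebra homomorphism with \<open>Var v \<mapsto> f v\<close>.\<close>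

lemma poly_subst_superset:
  assumes "finite M" "Poly_Mapping.keys p \<subseteq> M"
  shows "poly_subst f p =
     (\<Sum>m\<in>M. Const (Poly_Mapping.lookup p m) *
        (\<Prod>v\<in>Poly_Mapping.keys m. f v ^ Poly_Mapping.lookup m v))"
  unfolding poly_subst_def using assms
  by (intro sum.mono_neutral_left) (auto simp: in_keys_iff Const_def)

lemma poly_subst_add: "poly_subst f (p + q) = poly_subst f p + poly_subst f q"
proof -
  let ?M = "Poly_Mapping.keys p \<union> Poly_Mapping.keys q"
  have "Poly_Mapping.keys (p + q) \<subseteq> ?M" by (rule keys_add)
  then show ?thesis
    by (simp add: poly_subst_superset[of ?M] lookup_add Const_def single_add
        distrib_right sum.distrib)
qed

lemma poly_subst_sum: "poly_subst f (sum g A) = (\<Sum>a\<in>A. poly_subst f (g a))"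
  by (induction A rule: infinite_finite_induct)
     (simp_all add: poly_subst_add, simp_all add: poly_subst_def)

lemma poly_subst_single:
  "poly_subst f (Poly_Mapping.single m c) =
     Const c * (\<Prod>v\<in>Poly_Mapping.keys m. f v ^ Poly_Mapping.lookup m v)"
  by (cases "c = 0") (auto simp: poly_subst_def Const_def)

lemma poly_subst_Const: "poly_subst f (Const c) = Const c"
proof -
  have "poly_subst f (Const c) = poly_subst f (Poly_Mapping.single 0 c)"
    by (simp add: Const_def)
  then show ?thesis
    by (simp add: poly_subst_single)
qed

lemma poly_subst_Var: "poly_subst f (Var v) = f v"
  by (simp add: Var_def poly_subst_single) (simp add: Const_def)

lemma mpoly_eq_sum_single:
  "p = (\<Sum>m\<in>Poly_Mapping.keys p. Poly_Mapping.single m (Poly_Mapping.lookup p m))"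
  by (rule poly_mapping_eqI)
     (auto simp: lookup_sum lookup_single when_def in_keys_iff sum.delta' cong: if_cong)

lemma monom_subst_add:
  fixes f :: "'v \<Rightarrow> ('w, 'k::field) mpoly" and m n :: "'v \<Rightarrow>\<^sub>0 nat"
  shows "(\<Prod>v\<in>Poly_Mapping.keys (m + n). f v ^ Poly_Mapping.lookup (m + n) v) =
    (\<Prod>v\<in>Poly_Mapping.keys m. f v ^ Poly_Mapping.lookup m v) *
    (\<Prod>v\<in>Poly_Mapping.keys n. f v ^ Poly_Mapping.lookup n v)"
proof -
  let ?U = "Poly_Mapping.keys m \<union> Poly_Mapping.keys n"
  have ext: "(\<Prod>v\<in>Poly_Mapping.keys k. f v ^ Poly_Mapping.lookup k v) =
      (\<Prod>v\<in>?U. f v ^ Poly_Mapping.lookup k v)"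
    if "Poly_Mapping.keys k \<subseteq> ?U" for k :: "'v \<Rightarrow>\<^sub>0 nat"
    using that by (intro prod.mono_neutral_left) (auto simp: in_keys_iff)
  show ?thesis
    unfolding ext[of m, OF Un_upper1] ext[of n, OF Un_upper2] ext[of "m + n", OF keys_add]
    by (simp add: lookup_add power_add prod.distrib)
qed

lemma poly_subst_mult:
  fixes f :: "'v \<Rightarrow> ('w, 'k::field) mpoly"
  shows "poly_subst f (p * q) = poly_subst f p * poly_subst f q"
proof -
  have mono: "poly_subst f (Poly_Mapping.single m c * Poly_Mapping.single n d) =
      poly_subst f (Poly_Mapping.single m c) * poly_subst f (Poly_Mapping.single n d)" 
    for m n c d
  proof -
    have "Const (c * d) = (Const c * Const d :: ('w, 'k) mpoly)"
      by (simp add: Const_def mult_single)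
    then show ?thesis
      by (simp add: mult_single poly_subst_single monom_subst_add mult_ac)
  qed
  show ?thesis
    by (subst (1 2) mpoly_eq_sum_single[of p], subst (1 2) mpoly_eq_sum_single[of q])
       (simp add: sum_product poly_subst_sum mono)
qed

definition subalgebra :: "('v, 'k::field) mpoly set \<Rightarrow> bool" where
  "subalgebra A \<longleftrightarrow>
     range Const \<subseteq> A \<and> (\<forall>p\<in>A. \<forall>q\<in>A. p + q \<in> A \<and> p * q \<in> A)"

definition alg_gen :: "('v, 'k::field) mpoly set \<Rightarrow> ('v, 'k) mpoly set" where
  "alg_gen B = subalgebra hull B"

definition ideal_gen :: "'r::comm_ring_1 set \<Rightarrow> 'r set" where
  "ideal_gen B = module.span (*) B"

text \<open>Indexing by positions makes a repeated entry in the list redundant, so a minimal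
  generating list has pairwise distinct entries.\<close>

definition minimally_generates :: "('r set \<Rightarrow> 'r set) \<Rightarrow> 'r list \<Rightarrow> 'r set \<Rightarrow> bool" where
  "minimally_generates gen bs A \<longleftrightarrow>
     gen (set bs) = A \<and> (\<forall>I. I \<subset> {..<length bs} \<longrightarrow> gen ((\<lambda>i. bs ! i) ` I) \<noteq> A)"

typedef edge = "{{i, j} | i j :: nat. 1 \<le> i \<and> i < j \<and> j \<le> 4}"
  by (rule exI[of _ "{1, 2}"], rule CollectI, rule exI[of _ 1], rule exI[of _ 2]) simp

type_synonym 'k R_poly = "(edge, 'k) mpoly"

definition xe :: "nat \<Rightarrow> nat \<Rightarrow> 'k::field R_poly" where
  "xe i j = Var (Abs_edge {i, j})"

definition S4_act :: "(nat \<Rightarrow> nat) \<Rightarrow> 'k::field R_poly \<Rightarrow> 'k R_poly" where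
  "S4_act \<sigma> = poly_subst (\<lambda>e. Var (Abs_edge (\<sigma> ` Rep_edge e)))"

definition R_S4 :: "'k::field R_poly set" where
  "R_S4 = {p. \<forall>\<sigma>. \<sigma> permutes {1..4} \<longrightarrow> S4_act \<sigma> p = p}"

definition X1 :: "'k::field R_poly" where "X1 = xe 1 2 + xe 3 4"
definition X2 :: "'k::field R_poly" where "X2 = xe 1 3 + xe 2 4"
definition X3 :: "'k::field R_poly" where "X3 = xe 1 4 + xe 2 3"
definition Z1 :: "'k::field R_poly" where "Z1 = xe 1 2 - xe 3 4"
definition Z2 :: "'k::field R_poly" where "Z2 = xe 1 3 - xe 2 4"
definition Z3 :: "'k::field R_poly" where "Z3 = xe 1 4 - xe 2 3"

text \<open>\<open>br a b\<close> is \<open>[x^a z^b]\<close>.\<close>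

definition br :: "nat \<Rightarrow> nat \<Rightarrow> 'k::field R_poly" where
  "br a b = X1 ^ a * Z1 ^ b + X2 ^ a * Z2 ^ b + X3 ^ a * Z3 ^ b"

text \<open>The variable \<open>T_w\<close> is named after the monomial \<open>w\<close>, e.g. \<open>Tx2y\<close> has \<open>w = x^2 y\<close>.
  The inclusion of \<open>F_1\<close> into \<open>F\<close> sends \<open>Var v\<close> to \<open>Var (In v)\<close>.\<close>

datatype f1_var = Tx | Tx2 | Tx3 | Ty | Ty2 | Txy | Tx2y | Txy2 | TS

datatype f_var = In f1_var | Ty3

type_synonym 'k f1_poly = "(f1_var, 'k) mpoly"
type_synonym 'k f_poly = "(f_var, 'k) mpoly"

abbreviation t_x :: "'k::field f_poly" where "t_x \<equiv> Var (In Tx)"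
abbreviation t_x2 :: "'k::field f_poly" where "t_x2 \<equiv> Var (In Tx2)"
abbreviation t_x3 :: "'k::field f_poly" where "t_x3 \<equiv> Var (In Tx3)"
abbreviation t_y :: "'k::field f_poly" where "t_y \<equiv> Var (In Ty)"
abbreviation t_y2 :: "'k::field f_poly" where "t_y2 \<equiv> Var (In Ty2)"
abbreviation t_y3 :: "'k::field f_poly" where "t_y3 \<equiv> Var Ty3"
abbreviation t_xy :: "'k::field f_poly" where "t_xy \<equiv> Var (In Txy)"
abbreviation t_x2y :: "'k::field f_poly" where "t_x2y \<equiv> Var (In Tx2y)"
abbreviation t_xy2 :: "'k::field f_poly" where "t_xy2 \<equiv> Var (In Txy2)"

definition J32 :: "'k::field f_poly" where
  "J32 =
     6 * t_x2y * t_xy - 3 * t_xy2 * t_x2 - 2 * t_x2y * t_x * t_y + t_xy2 * t_x^2 - 4 * t_xy^2 * t_x + 2 * t_xy * t_x^2 * t_y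
     - 3 * t_x3 * t_y2 + 4 * t_x2 * t_x * t_y2 - t_x^3 * t_y2 + t_x3 * t_y^2 - t_x2 * t_x * t_y^2"

definition J23 :: "'k::field f_poly" where
  "J23 =
     6 * t_xy2 * t_xy - 3 * t_x2y * t_y2 - 2 * t_xy2 * t_x * t_y + t_x2y * t_y^2 - 4 * t_xy^2 * t_y + 2 * t_xy * t_y^2 * t_x
     - 3 * t_y3 * t_x2 + 4 * t_y2 * t_y * t_x2 - t_y^3 * t_x2 + t_y3 * t_x^2 - t_y2 * t_y * t_x^2"

definition J42 :: "'k::field f_poly" where
  "J42 =
     6 * t_x2y^2 + t_xy^2 * t_x2 - 3 * t_xy^2 * t_x^2 - 6 * t_x3 * t_xy2 + 2 * t_x2 * t_xy2 * t_x + 4 * t_x3 * t_xy * t_y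
     - 2 * t_x2 * t_xy * t_x * t_y + 2 * t_xy * t_x^3 * t_y - 4 * t_x2y * t_x2 * t_y - t_x2^2 * t_y2 + t_x2^2 * t_y^2
     + 4 * t_x2 * t_x^2 * t_y2 - t_x2 * t_x^2 * t_y^2 - t_x^4 * t_y2 - 2 * t_x3 * t_x * t_y2"

definition J33 :: "'k::field f_poly" where
  "J33 =
     3 * t_x2y * t_xy2 - t_xy * t_x2 * t_y2 + t_xy^3 + t_xy * t_x^2 * t_y2 - 5 * t_xy^2 * t_x * t_y - 3 * t_x3 * t_y3
     + 2 * t_xy * t_xy2 * t_x + t_x2 * t_x * t_y3 - 3 * t_x2 * t_xy2 * t_y + 2 * t_x2y * t_xy * t_y + 3 * t_x2 * t_x * t_y2 * t_y
     + t_x3 * t_y2 * t_y + t_x2 * t_xy * t_y^2 - t_x^3 * t_y2 * t_y + 2 * t_x^2 * t_xy * t_y^2 - t_x2 * t_x * t_y^3 - 3 * t_x * t_x2y * t_y2"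

definition J24 :: "'k::field f_poly" where
  "J24 =
     6 * t_xy2^2 + t_xy^2 * t_y2 - 3 * t_xy^2 * t_y^2 - 6 * t_y3 * t_x2y + 2 * t_y2 * t_x2y * t_y + 4 * t_y3 * t_xy * t_x
     - 2 * t_y2 * t_xy * t_x * t_y + 2 * t_xy * t_y^3 * t_x - 4 * t_xy2 * t_y2 * t_x - t_y2^2 * t_x2 + t_y2^2 * t_x^2
     + 4 * t_y2 * t_y^2 * t_x2 - t_y2 * t_y^2 * t_x^2 - t_y^4 * t_x2 - 2 * t_y3 * t_y * t_x2"

definition tilde :: "'k::field f_poly \<Rightarrow> 'k f1_poly" where
  "tilde = poly_subst (\<lambda>v. case v of
       In u \<Rightarrow> Var u
     | Ty3 \<Rightarrow> 3 * Var TS ^ 2 + Const (3 / 2) * Var Ty2 * Var Ty - Const (1 / 2) * Var Ty ^ 3)"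

definition phi1 :: "'k::field f1_poly \<Rightarrow> 'k R_poly" where
  "phi1 = poly_subst (\<lambda>v. case v of
       Tx \<Rightarrow> br 1 0 | Tx2 \<Rightarrow> br 2 0 | Tx3 \<Rightarrow> br 3 0
     | Ty \<Rightarrow> br 0 2 | Ty2 \<Rightarrow> br 0 4
     | Txy \<Rightarrow> br 1 2 | Tx2y \<Rightarrow> br 2 2 | Txy2 \<Rightarrow> br 1 4
     | TS \<Rightarrow> Z1 * Z2 * Z3)"

end

theory Submission
  imports Defs
begin

text \<open>
  In the coordinates \<open>x\<^sub>i\<close>, \<open>z\<^sub>i\<close> the group \<open>S\<^sub>4\<close> acts by the permutations of the three pairs
  \<open>(x\<^sub>i, z\<^sub>i)\<close> together with the sign changes of an even number of the \<open>z\<^sub>i\<close>. Write \<open>y\<^sub>i = z\<^sub>i\<^sup>2\<close>.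
  Averaging over the Klein four-group, which acts by the sign changes, leaves the products of powers
  of \<open>z\<^sub>1z\<^sub>2z\<^sub>3\<close> with monomials in the \<open>x\<^sub>i\<close> and \<open>y\<^sub>i\<close>. Averaging over the stabilizer of the letter 1,
  which permutes the pairs without changing signs, then gives symmetric functions of the three points
  \<open>(x\<^sub>i, y\<^sub>i)\<close>, and these are polynomials in the power sums \<open>[x\<^sup>ay\<^sup>b]\<close>. A power sum of degree at
  least four reduces to smaller ones, because four indices cannot be distinct among three; and
  \<open>[y\<^sup>3]\<close> is given by \<open>(z\<^sub>1z\<^sub>2z\<^sub>3)\<^sup>2\<close> and Newton's identity. Only 2 and 3 are inverted
  (\<open>psum_in_alg_gen\<close>, \<open>R_S4_eq\<close>).

  The kernel is found by comparing with a free module. Let \<open>P\<close> be the polynomial ring in the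
  variables \<open>Tx\<close>, \<open>Tx2\<close>, \<open>Tx3\<close>, \<open>Ty\<close>, \<open>Ty2\<close>, \<open>TS\<close>, whose images are invariant under independent
  permutations of the \<open>x\<^sub>i\<close> and of the \<open>z\<^sub>i\<close>, and write \<open>a\<close>, \<open>b\<close>, \<open>c\<close> for the other three variables
  \<open>Txy\<close>, \<open>Tx2y\<close>, \<open>Txy2\<close>. The five relations have the leading products \<open>ab\<close>, \<open>ac\<close>, \<open>b\<^sup>2\<close>, \<open>a\<^sup>3 + 3bc\<close>, \<open>c\<^sup>2\<close>, and
  modulo them every polynomial is a combination of \<open>1\<close>, \<open>a\<close>, \<open>b\<close>, \<open>c\<close>, \<open>a\<^sup>2\<close>, \<open>a\<^sup>3\<close> with coefficients in \<open>P\<close>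
  (\<open>nf_span_nf_basis\<close>). If such a combination is mapped to zero, permuting the \<open>z\<^sub>i\<close> alone gives six
  equations with the same six coefficients, which force the coefficients to be mapped to zero
  (\<open>permuted_points_independent\<close>); and the images of the variables of \<open>P\<close> are algebraically independent
  (\<open>phi_coord_inj_on_prim\<close>). Hence the relations, which do vanish, generate the kernel.

  For each relation there is a point where it is nonzero and the other four are zero, so none of the
  five can be omitted. On each coordinate axis every relation is a multiple of the square of the
  coordinate, so the kernel contains no polynomial \<open>Var v - q\<close> with \<open>q\<close> free of \<open>v\<close>; therefore no generator of the
  invariant algebra lies in the algebra generated by the other eight.
\<close>

section \<open>Substitution homomorphisms, generated subalgebras and ideals\<close>

lemma Const_0 [simp]: "Const 0 = 0"
  by (simp add: Const_def)

lemma Const_1 [simp]: "Const 1 = 1"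
  by (simp add: Const_def)

lemma Const_add: "Const (a + b) = Const a + Const b"
  by (simp add: Const_def single_add)

lemma Const_mult: "Const (a * b) = Const a * Const b"
  by (simp add: Const_def mult_single)

lemma Const_of_nat: "Const (of_nat n) = of_nat n"
  by (induction n) (simp_all add: Const_add)

lemma Const_numeral: "Const (numeral n) = numeral n"
  using Const_of_nat[of "numeral n"] by simp

lemma Const_uminus: "Const (- a) = - Const a"
  using Const_add[of a "- a"] by (simp add: eq_neg_iff_add_eq_0 add.commute)

lemma Const_inj: "Const a = Const b \<longleftrightarrow> a = b"
  unfolding Const_def by (metis lookup_single_eq)

lemma Const_eq_0_iff [simp]: "Const a = 0 \<longleftrightarrow> a = 0"
  using Const_inj[of a 0] by simp

lemma numeral_mpoly_neq_0:
  "(numeral n :: ('v, 'k::field) mpoly) \<noteq> 0" if "(numeral n :: 'k) \<noteq> 0"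
  using that by (simp flip: Const_numeral)

lemma Const_inverse_numeral_mult:
  "Const (1 / numeral n) * (numeral n * p) = (p :: ('v, 'k::field) mpoly)"
  if "(numeral n :: 'k) \<noteq> 0"
  using that by (simp flip: Const_numeral mult.assoc Const_mult)

lemma Var_neq_0 [simp]: "Var v \<noteq> (0 :: ('v, 'k::field) mpoly)"
  unfolding Var_def by (metis lookup_single_eq lookup_zero zero_neq_one)

lemma poly_subst_0: "poly_subst f 0 = 0"
  by (simp add: poly_subst_def)

lemma poly_subst_1: "poly_subst f 1 = 1"
  using poly_subst_Const[of f 1] by simp

lemma poly_subst_uminus: "poly_subst f (- p) = - poly_subst f p"
  using poly_subst_add[of f p "- p"]
  by (simp add: poly_subst_0 eq_neg_iff_add_eq_0 add.commute)

lemma poly_subst_diff: "poly_subst f (p - q) = poly_subst f p - poly_subst f q"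
  using poly_subst_add[of f p "- q"] by (simp add: poly_subst_uminus)

lemma poly_subst_power: "poly_subst f (p ^ n) = poly_subst f p ^ n"
  by (induction n) (simp_all add: poly_subst_1 poly_subst_mult)

lemma poly_subst_numeral: "poly_subst f (numeral n) = numeral n"
  using poly_subst_Const[of f "numeral n"] by (simp add: Const_numeral)

lemmas poly_subst_hom =
  poly_subst_0 poly_subst_1 poly_subst_add poly_subst_mult poly_subst_uminus poly_subst_diff
  poly_subst_power poly_subst_numeral poly_subst_Const poly_subst_Var

lemma single_eq_prod_Var:
  "Poly_Mapping.single m c =
     Const c * (\<Prod>v\<in>Poly_Mapping.keys m. Var v ^ Poly_Mapping.lookup m v)"
proof -
  have single_power: "Poly_Mapping.single (Poly_Mapping.single v n) 1 = (Var v ^ n :: ('v, 'k::field) mpoly)"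
    for v :: 'v and n
  proof (induction n)
    case (Suc n)
    have "Poly_Mapping.single v (Suc n) = Poly_Mapping.single v 1 + Poly_Mapping.single v n"
      by (simp flip: single_add)
    then have "Poly_Mapping.single (Poly_Mapping.single v (Suc n)) 1 =
        (Var v * Poly_Mapping.single (Poly_Mapping.single v n) 1 :: ('v, 'k) mpoly)"
      by (simp add: Var_def mult_single)
    with Suc show ?case by simp
  qed simp
  have single_sum: "Poly_Mapping.single (\<Sum>v\<in>V. g v) 1 =
      (\<Prod>v\<in>V. Poly_Mapping.single (g v) 1 :: ('v, 'k::field) mpoly)"
    for g :: "'v \<Rightarrow> 'v \<Rightarrow>\<^sub>0 nat" and V
  proof (induction V rule: infinite_finite_induct)
    case (insert v V)
    have "Poly_Mapping.single (g v + sum g V) 1 =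
        (Poly_Mapping.single (g v) 1 * Poly_Mapping.single (sum g V) 1 :: ('v, 'k) mpoly)"
      by (simp add: mult_single)
    with insert show ?case by simp
  qed simp_all
  have "Poly_Mapping.single m c = Const c * Poly_Mapping.single m 1"
    by (simp add: Const_def mult_single)
  also have "Poly_Mapping.single m (1 :: 'b) =
      Poly_Mapping.single (\<Sum>v\<in>Poly_Mapping.keys m. Poly_Mapping.single v (Poly_Mapping.lookup m v)) 1"
    by (simp flip: mpoly_eq_sum_single)
  finally show ?thesis by (simp add: single_sum single_power)
qed

lemma mpoly_induct [case_names Const Var add mult]:
  fixes P :: "('v, 'k::field) mpoly \<Rightarrow> bool"
  assumes Const: "\<And>c. P (Const c)" and Var: "\<And>v. P (Var v)"
    and add: "\<And>p q. P p \<Longrightarrow> P q \<Longrightarrow> P (p + q)"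
    and mult: "\<And>p q. P p \<Longrightarrow> P q \<Longrightarrow> P (p * q)"
  shows "P p"
proof -
  have power: "P (q ^ n)" if "P q" for q n
    by (induction n) (use that Const[of 1] in \<open>auto intro: mult\<close>)
  have prod: "P (prod g V)" if "\<And>v. P (g v)" for g :: "'v \<Rightarrow> ('v, 'k) mpoly" and V
    by (induction V rule: infinite_finite_induct) (use that Const[of 1] in \<open>auto intro: mult\<close>)
  have sum: "P (sum g V)" if "\<And>v. P (g v)" for g :: "('v \<Rightarrow>\<^sub>0 nat) \<Rightarrow> ('v, 'k) mpoly" and V
    by (induction V rule: infinite_finite_induct) (use that Const[of 0] in \<open>auto intro: add\<close>)
  show ?thesis
    by (subst mpoly_eq_sum_single[of p])
       (auto simp: single_eq_prod_Var intro!: sum mult prod power Const Var)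
qed

lemma poly_subst_comp: "poly_subst g (poly_subst f p) = poly_subst (\<lambda>v. poly_subst g (f v)) p"
  by (induction p rule: mpoly_induct) (simp_all add: poly_subst_hom)

lemma subalgebra_alg_gen: "subalgebra (alg_gen B)"
  unfolding alg_gen_def by (rule hull_in) (fastforce simp: subalgebra_def)

lemma alg_gen_base: "p \<in> B \<Longrightarrow> p \<in> alg_gen B"
  unfolding alg_gen_def by (rule hull_inc)

lemma alg_gen_Const: "Const c \<in> alg_gen B"
  using subalgebra_alg_gen[of B] by (auto simp: subalgebra_def)

lemma alg_gen_add: "p \<in> alg_gen B \<Longrightarrow> q \<in> alg_gen B \<Longrightarrow> p + q \<in> alg_gen B"
  using subalgebra_alg_gen[of B] by (auto simp: subalgebra_def)

lemma alg_gen_mult: "p \<in> alg_gen B \<Longrightarrow> q \<in> alg_gen B \<Longrightarrow> p * q \<in> alg_gen B"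
  using subalgebra_alg_gen[of B] by (auto simp: subalgebra_def)

lemma alg_gen_0: "0 \<in> alg_gen B"
  using alg_gen_Const[of 0] by simp

lemma alg_gen_1: "1 \<in> alg_gen B"
  using alg_gen_Const[of 1] by simp

lemma alg_gen_numeral: "numeral n \<in> alg_gen B"
  using alg_gen_Const[of "numeral n"] by (simp add: Const_numeral)

lemma alg_gen_uminus: "p \<in> alg_gen B \<Longrightarrow> - p \<in> alg_gen B"
  using alg_gen_mult[OF alg_gen_Const[of "-1"], of p B] by (simp add: Const_uminus)

lemma alg_gen_diff: "p \<in> alg_gen B \<Longrightarrow> q \<in> alg_gen B \<Longrightarrow> p - q \<in> alg_gen B"
  using alg_gen_add[OF _ alg_gen_uminus, of p B q] by simp

lemma alg_gen_power: "p \<in> alg_gen B \<Longrightarrow> p ^ n \<in> alg_gen B"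
  by (induction n) (simp_all add: alg_gen_1 alg_gen_mult)

lemmas alg_gen_closed =
  alg_gen_0 alg_gen_1 alg_gen_numeral alg_gen_Const alg_gen_add alg_gen_mult alg_gen_uminus
  alg_gen_diff alg_gen_power

lemma alg_gen_divide_numeral:
  "p \<in> alg_gen B" if "numeral n * p \<in> alg_gen B" "(numeral n :: 'k) \<noteq> 0"
  for p :: "('v, 'k::field) mpoly"
  using alg_gen_mult[OF alg_gen_Const[of "1 / numeral n"] that(1)]
    Const_inverse_numeral_mult[OF that(2), of p] by simp

lemma alg_gen_minimal: "B \<subseteq> A \<Longrightarrow> subalgebra A \<Longrightarrow> alg_gen B \<subseteq> A"
  unfolding alg_gen_def by (rule hull_minimal)

lemma alg_gen_mono: "B \<subseteq> C \<Longrightarrow> alg_gen B \<subseteq> alg_gen C"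
  unfolding alg_gen_def by (rule hull_mono)

lemma alg_gen_induct [consumes 1, case_names base Const add mult]:
  assumes "p \<in> alg_gen B" and "\<And>b. b \<in> B \<Longrightarrow> P b" and "\<And>c. P (Const c)"
    and "\<And>p q. P p \<Longrightarrow> P q \<Longrightarrow> P (p + q)" and "\<And>p q. P p \<Longrightarrow> P q \<Longrightarrow> P (p * q)"
  shows "P p"
  using alg_gen_minimal[of B "{p. P p}"] assms by (auto simp: subalgebra_def)

text \<open>A homomorphism maps a generated subalgebra onto the subalgebra generated by the images; so
  membership in \<open>alg_gen (f ` V)\<close> can be pulled back to a polynomial in the variables \<open>V\<close>.\<close>

lemma alg_gen_image_poly_subst:
  fixes f :: "'v \<Rightarrow> ('w, 'k::field) mpoly"
  shows "alg_gen (f ` V) = poly_subst f ` alg_gen (Var ` V)"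
proof
  have "subalgebra (poly_subst f ` alg_gen (Var ` V))"
    unfolding subalgebra_def
  proof (intro conjI ballI subsetI)
    fix p assume "p \<in> range (Const :: 'k \<Rightarrow> ('w, 'k) mpoly)"
    then show "p \<in> poly_subst f ` alg_gen (Var ` V)"
      using poly_subst_Const[of f, symmetric] by (blast intro: alg_gen_Const)
  next
    fix p q assume "p \<in> poly_subst f ` alg_gen (Var ` V)" "q \<in> poly_subst f ` alg_gen (Var ` V)"
    then obtain p' q' where *: "p' \<in> alg_gen (Var ` V)" "q' \<in> alg_gen (Var ` V)"
        "p = poly_subst f p'" "q = poly_subst f q'" by blast
    show "p + q \<in> poly_subst f ` alg_gen (Var ` V)"
      unfolding *(3,4) poly_subst_add[symmetric] using *(1,2) by (intro imageI alg_gen_add)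
    show "p * q \<in> poly_subst f ` alg_gen (Var ` V)"
      unfolding *(3,4) poly_subst_mult[symmetric] using *(1,2) by (intro imageI alg_gen_mult)
  qed
  moreover have "f ` V \<subseteq> poly_subst f ` alg_gen (Var ` V)"
    using poly_subst_Var[of f, symmetric] by (blast intro: alg_gen_base)
  ultimately show "alg_gen (f ` V) \<subseteq> poly_subst f ` alg_gen (Var ` V)"
    by (rule alg_gen_minimal[rotated])
  have "poly_subst f p \<in> alg_gen (f ` V)" if "p \<in> alg_gen (Var ` V)" for p
    using that
    by (induction p rule: alg_gen_induct) (auto simp: poly_subst_hom intro: alg_gen_closed alg_gen_base)
  then show "poly_subst f ` alg_gen (Var ` V) \<subseteq> alg_gen (f ` V)" by blast
qed

lemma alg_gen_range_Var: "alg_gen (range Var) = UNIV"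
proof -
  have "p \<in> alg_gen (range Var)" for p :: "('a, 'b::field) mpoly"
    by (induction p rule: mpoly_induct) (auto intro: alg_gen_closed alg_gen_base)
  then show ?thesis by blast
qed

lemma range_poly_subst: "range (poly_subst f) = alg_gen (range f)"
  using alg_gen_image_poly_subst[of f UNIV] by (simp add: alg_gen_range_Var)

lemma poly_subst_cong_alg_gen:
  assumes "p \<in> alg_gen B" "\<And>b. b \<in> B \<Longrightarrow> poly_subst f b = poly_subst g b"
  shows "poly_subst f p = poly_subst g p"
  using assms by (induction p rule: alg_gen_induct) (simp_all add: poly_subst_hom)

lemma module_mult: "module ((*) :: 'r::comm_ring_1 \<Rightarrow> 'r \<Rightarrow> 'r)"
  by unfold_locales (simp_all add: algebra_simps)

lemma ideal_gen_base: "p \<in> B \<Longrightarrow> p \<in> ideal_gen B"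
  unfolding ideal_gen_def by (rule module.span_base[OF module_mult])

lemma ideal_gen_0: "0 \<in> ideal_gen B"
  unfolding ideal_gen_def by (rule module.span_zero[OF module_mult])

lemma ideal_gen_add: "p \<in> ideal_gen B \<Longrightarrow> q \<in> ideal_gen B \<Longrightarrow> p + q \<in> ideal_gen B"
  unfolding ideal_gen_def by (rule module.span_add[OF module_mult])

lemma ideal_gen_mult: "q \<in> ideal_gen B \<Longrightarrow> p * q \<in> ideal_gen B"
  unfolding ideal_gen_def by (rule module.span_scale[OF module_mult])

lemma ideal_gen_mono: "B \<subseteq> C \<Longrightarrow> ideal_gen B \<subseteq> ideal_gen C"
  unfolding ideal_gen_def by (rule module.span_mono[OF module_mult])

lemma ideal_gen_induct [consumes 1, case_names zero step]:
  assumes "p \<in> ideal_gen B" "P 0" "\<And>b q r. b \<in> B \<Longrightarrow> P q \<Longrightarrow> P (r * b + q)"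
  shows "P p"
  using assms unfolding ideal_gen_def
  by (rule module.span_induct_alt[OF module_mult])

lemma poly_subst_ideal_gen_eq_0:
  assumes "p \<in> ideal_gen B" "\<And>b. b \<in> B \<Longrightarrow> poly_subst f b = 0"
  shows "poly_subst f p = 0"
  using assms by (induction p rule: ideal_gen_induct) (simp_all add: poly_subst_hom)

text \<open>For a monotone closure operator a proper subset of the positions misses some position \<open>i\<close>, and it
  generates no more than all the positions other than \<open>i\<close>.\<close>

lemma minimally_generates_if_irredundant:
  assumes mono: "\<And>B C. B \<subseteq> C \<Longrightarrow> gen B \<subseteq> gen C"
    and gen: "gen (set bs) = A"
    and base: "\<And>b. b \<in> set bs \<Longrightarrow> b \<in> A"
    and irredundant: "\<And>i. i < length bs \<Longrightarrow> bs ! i \<notin> gen ((!) bs ` ({..<length bs} - {i}))"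
  shows "minimally_generates gen bs A"
  unfolding minimally_generates_def
proof (intro conjI allI impI gen notI)
  fix I assume I: "I \<subset> {..<length bs}" and eq: "gen ((!) bs ` I) = A"
  then obtain i where i: "i < length bs" "I \<subseteq> {..<length bs} - {i}" by blast
  have "bs ! i \<in> A" using base i by simp
  moreover have "A \<subseteq> gen ((!) bs ` ({..<length bs} - {i}))"
    using mono[OF image_mono[OF i(2), of "(!) bs"]] eq by simp
  ultimately show False using irredundant[OF i(1)] by blast
qed

section \<open>Identities for triples of points\<close>

definition psum :: "'r::comm_ring_1 \<Rightarrow> 'r \<Rightarrow> 'r \<Rightarrow> 'r \<Rightarrow> 'r \<Rightarrow> 'r \<Rightarrow> nat \<Rightarrow> nat \<Rightarrow> 'r" where
  "psum x1 x2 x3 z1 z2 z3 a b = x1 ^ a * z1 ^ b + x2 ^ a * z2 ^ b + x3 ^ a * z3 ^ b"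

text \<open>The values of the nine generators at an arbitrary point. The choice of \<open>X\<^sub>i\<close>, \<open>Z\<^sub>i\<close> as the point
  gives \<open>phi1\<close>; the other points are specializations and permutations of the coordinates.\<close>

definition gen_at :: "'r::comm_ring_1 \<Rightarrow> 'r \<Rightarrow> 'r \<Rightarrow> 'r \<Rightarrow> 'r \<Rightarrow> 'r \<Rightarrow> f1_var \<Rightarrow> 'r" where
  "gen_at x1 x2 x3 z1 z2 z3 v = (let p = psum x1 x2 x3 z1 z2 z3 in case v of
       Tx \<Rightarrow> p 1 0 | Tx2 \<Rightarrow> p 2 0 | Tx3 \<Rightarrow> p 3 0 | Ty \<Rightarrow> p 0 2 | Ty2 \<Rightarrow> p 0 4
     | Txy \<Rightarrow> p 1 2 | Tx2y \<Rightarrow> p 2 2 | Txy2 \<Rightarrow> p 1 4 | TS \<Rightarrow> z1 * z2 * z3)"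

lemma br_eq_psum: "br = psum X1 X2 X3 Z1 Z2 Z3"
  by (intro ext) (simp add: br_def psum_def)

lemma phi1_eq: "phi1 = poly_subst (gen_at X1 X2 X3 Z1 Z2 Z3)"
  unfolding phi1_def by (rule arg_cong[where f = poly_subst])
    (auto simp: fun_eq_iff gen_at_def br_eq_psum split: f1_var.split)

lemma poly_subst_gen_at:
  "poly_subst f (gen_at x1 x2 x3 z1 z2 z3 v) =
     gen_at (poly_subst f x1) (poly_subst f x2) (poly_subst f x3)
            (poly_subst f z1) (poly_subst f z2) (poly_subst f z3) v"
  by (cases v) (simp_all add: gen_at_def psum_def poly_subst_hom)

lemma poly_subst_comp_gen_at:
  "poly_subst f (poly_subst (gen_at x1 x2 x3 z1 z2 z3) p) =
     poly_subst (gen_at (poly_subst f x1) (poly_subst f x2) (poly_subst f x3)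
                        (poly_subst f z1) (poly_subst f z2) (poly_subst f z3)) p"
  by (simp add: poly_subst_comp poly_subst_gen_at)

text \<open>A sum over the bijections from three factors to three points, expanded over all maps by
  inclusion and exclusion: collapsing a set partition of the factors contributes a product of
  power sums.\<close>

lemma three_point_product_sum:
  fixes u1 u2 u3 v1 v2 v3 w1 w2 w3 :: "'r::comm_ring_1"
  shows "u1*v2*w3 + u1*v3*w2 + u2*v1*w3 + u2*v3*w1 + u3*v1*w2 + u3*v2*w1 =
    (u1+u2+u3) * (v1+v2+v3) * (w1+w2+w3) - (u1*v1+u2*v2+u3*v3) * (w1+w2+w3)
    - (u1*w1+u2*w2+u3*w3) * (v1+v2+v3) - (v1*w1+v2*w2+v3*w3) * (u1+u2+u3)
    + 2 * (u1*v1*w1+u2*v2*w2+u3*v3*w3)"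
  by (simp add: algebra_simps)

text \<open>There is no injection from four factors to three points, so the inclusion-exclusion sum over the
  set partitions of the four factors is zero. The partition with a single block has
  coefficient \<open>-6\<close>, which expresses its power sum by the others.\<close>

lemma three_point_fourfold_sum:
  fixes u1 u2 u3 v1 v2 v3 w1 w2 w3 t1 t2 t3 :: "'r::comm_ring_1"
  shows "6 * (u1*v1*w1*t1 + u2*v2*w2*t2 + u3*v3*w3*t3) =
      2 * (u1*v1*w1+u2*v2*w2+u3*v3*w3) * (t1+t2+t3) + 2 * (u1*v1*t1+u2*v2*t2+u3*v3*t3) * (w1+w2+w3)
    + 2 * (u1*w1*t1+u2*w2*t2+u3*w3*t3) * (v1+v2+v3) + 2 * (v1*w1*t1+v2*w2*t2+v3*w3*t3) * (u1+u2+u3)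
    + (u1*v1+u2*v2+u3*v3) * (w1*t1+w2*t2+w3*t3) + (u1*w1+u2*w2+u3*w3) * (v1*t1+v2*t2+v3*t3)
    + (u1*t1+u2*t2+u3*t3) * (v1*w1+v2*w2+v3*w3)
    - (u1*v1+u2*v2+u3*v3) * (w1+w2+w3) * (t1+t2+t3) - (u1*w1+u2*w2+u3*w3) * (v1+v2+v3) * (t1+t2+t3)
    - (u1*t1+u2*t2+u3*t3) * (v1+v2+v3) * (w1+w2+w3) - (v1*w1+v2*w2+v3*w3) * (u1+u2+u3) * (t1+t2+t3)
    - (v1*t1+v2*t2+v3*t3) * (u1+u2+u3) * (w1+w2+w3) - (w1*t1+w2*t2+w3*t3) * (u1+u2+u3) * (v1+v2+v3)
    + (u1+u2+u3) * (v1+v2+v3) * (w1+w2+w3) * (t1+t2+t3)"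
  by (simp add: algebra_simps)

lemma psum_reduction:
  fixes x1 x2 x3 z1 z2 z3 :: "'r::comm_ring_1"
  defines "p \<equiv> psum x1 x2 x3 z1 z2 z3"
  shows "6 * p (a+a'+a''+a''') (b+b'+b''+b''') =
      2 * p (a+a'+a'') (b+b'+b'') * p a''' b''' + 2 * p (a+a'+a''') (b+b'+b''') * p a'' b''
    + 2 * p (a+a''+a''') (b+b''+b''') * p a' b' + 2 * p (a'+a''+a''') (b'+b''+b''') * p a b
    + p (a+a') (b+b') * p (a''+a''') (b''+b''') + p (a+a'') (b+b'') * p (a'+a''') (b'+b''')
    + p (a+a''') (b+b''') * p (a'+a'') (b'+b'')
    - p (a+a') (b+b') * p a'' b'' * p a''' b''' - p (a+a'') (b+b'') * p a' b' * p a''' b'''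
    - p (a+a''') (b+b''') * p a' b' * p a'' b'' - p (a'+a'') (b'+b'') * p a b * p a''' b'''
    - p (a'+a''') (b'+b''') * p a b * p a'' b'' - p (a''+a''') (b''+b''') * p a b * p a' b'
    + p a b * p a' b' * p a'' b'' * p a''' b'''"
  using three_point_fourfold_sum[of
      "x1^a*z1^b" "x1^a'*z1^b'" "x1^a''*z1^b''" "x1^a'''*z1^b'''"
      "x2^a*z2^b" "x2^a'*z2^b'" "x2^a''*z2^b''" "x2^a'''*z2^b'''"
      "x3^a*z3^b" "x3^a'*z3^b'" "x3^a''*z3^b''" "x3^a'''*z3^b'''"]
  by (simp add: p_def psum_def power_add mult_ac)

lemma psum_product_sum:
  fixes x1 x2 x3 z1 z2 z3 :: "'r::comm_ring_1" and a a' a'' b b' b'' :: nat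
  defines "p \<equiv> psum x1 x2 x3 z1 z2 z3"
    and "m \<equiv> \<lambda>x1 x2 x3 z1 z2 z3. x1^a * z1^b * (x2^a' * z2^b') * (x3^a'' * z3^b'')"
  shows "m x1 x2 x3 z1 z2 z3 + m x1 x3 x2 z1 z3 z2 + m x2 x1 x3 z2 z1 z3 + m x3 x1 x2 z3 z1 z2
      + m x2 x3 x1 z2 z3 z1 + m x3 x2 x1 z3 z2 z1 =
    p a b * p a' b' * p a'' b'' - p (a+a') (b+b') * p a'' b'' - p (a+a'') (b+b'') * p a' b'
    - p (a'+a'') (b'+b'') * p a b + 2 * p (a+a'+a'') (b+b'+b'')"
  using three_point_product_sum[of
      "x1^a*z1^b" "x2^a'*z2^b'" "x3^a''*z3^b''" "x3^a'*z3^b'" "x2^a''*z2^b''"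
      "x2^a*z2^b" "x1^a'*z1^b'" "x1^a''*z1^b''" "x3^a*z3^b"]
  by (simp add: p_def m_def psum_def power_add mult_ac add_ac)

text \<open>Newton's identity for the third power sum of the \<open>z\<^sub>i\<^sup>2\<close>, whose third elementary symmetric function
  is the square of \<open>z\<^sub>1z\<^sub>2z\<^sub>3\<close>.\<close>

lemma psum_0_6:
  "2 * psum x1 x2 x3 z1 z2 z3 0 6 =
     6 * (z1 * z2 * z3)^2 + 3 * psum x1 x2 x3 z1 z2 z3 0 4 * psum x1 x2 x3 z1 z2 z3 0 2
     - psum x1 x2 x3 z1 z2 z3 0 2 ^ 3"
proof -
  have "2 * (y1^3 + y2^3 + y3^3) = 6 * (y1 * y2 * y3) + 3 * (y1^2 + y2^2 + y3^2) * (y1 + y2 + y3)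
      - (y1 + y2 + y3) ^ 3" for y1 y2 y3 :: 'a
    by (simp add: algebra_simps power2_eq_square power3_eq_cube)
  from this[of "z1^2" "z2^2" "z3^2"] show ?thesis
    by (simp add: psum_def power_mult_distrib flip: power_mult)
qed

lemma split_degree_into_four:
  assumes "4 \<le> a + (b :: nat)"
  obtains a1 a2 a3 a4 b1 b2 b3 b4 where "a = a1 + a2 + a3 + a4" "b = b1 + b2 + b3 + b4"
    "0 < a1 + b1" "0 < a2 + b2" "0 < a3 + b3" "0 < a4 + b4"
proof -
  consider "a \<ge> 3" | "a = 2" "b \<ge> 2" | "a = 1" "b \<ge> 3" | "a = 0" "b \<ge> 4"
    using assms by linarith
  then show ?thesis
  proof cases
    case 1 then show ?thesis using assms by (intro that[of 1 1 1 "a - 3" 0 0 0 b]) auto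
  next
    case 2 then show ?thesis by (intro that[of 1 1 0 0 0 0 1 "b - 1"]) auto
  next
    case 3 then show ?thesis by (intro that[of 1 0 0 0 0 1 1 "b - 2"]) auto
  next
    case 4 then show ?thesis by (intro that[of 0 0 0 0 1 1 1 "b - 3"]) auto
  qed
qed

text \<open>By induction on the degree: a monomial \<open>x\<^sup>ay\<^sup>b\<close> of degree at least four is a product of four
  nontrivial monomials, and \<open>psum_reduction\<close> writes six times its power sum in terms of power sums
  of lower degree.\<close>

lemma psum_in_alg_gen:
  fixes x1 x2 x3 z1 z2 z3 :: "('v, 'k::field) mpoly"
  assumes char: "(2 :: 'k) \<noteq> 0" "(3 :: 'k) \<noteq> 0"
  shows "psum x1 x2 x3 z1 z2 z3 a (2 * b) \<in> alg_gen (range (gen_at x1 x2 x3 z1 z2 z3))"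
    (is "_ \<in> ?A")
proof (induction "a + b" arbitrary: a b rule: less_induct)
  case less
  define q where "q a b = psum x1 x2 x3 z1 z2 z3 a (2 * b)" for a b
  have gen: "gen_at x1 x2 x3 z1 z2 z3 v \<in> ?A" for v
    by (rule alg_gen_base) simp
  show ?case
  proof (cases "a + b \<ge> 4")
    case True
    then obtain a1 a2 a3 a4 b1 b2 b3 b4 where ab: "a = a1 + a2 + a3 + a4" "b = b1 + b2 + b3 + b4"
        "0 < a1 + b1" "0 < a2 + b2" "0 < a3 + b3" "0 < a4 + b4"
      by (rule split_degree_into_four)
    have IH: "q a' b' \<in> ?A" if "a' + b' < a + b" for a' b'
      unfolding q_def using that by (rule less)
    have "6 * q a b \<in> ?A"
      unfolding q_def ab(1,2) distrib_left psum_reduction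
      unfolding distrib_left[symmetric] q_def[symmetric]
      using ab by (intro alg_gen_closed IH; linarith)
    moreover have "(6 :: 'k) \<noteq> 0"
      using char mult_eq_0_iff[of "2 :: 'k" 3] by simp
    ultimately show ?thesis
      unfolding q_def by (rule alg_gen_divide_numeral)
  next
    case False
    have "2 * psum x1 x2 x3 z1 z2 z3 0 6 \<in> ?A"
      unfolding psum_0_6 using gen[of TS] gen[of Ty] gen[of Ty2]
      by (simp add: gen_at_def alg_gen_closed)
    then have cube: "psum x1 x2 x3 z1 z2 z3 0 6 \<in> ?A"
      using char(1) by (rule alg_gen_divide_numeral)
    have "psum x1 x2 x3 z1 z2 z3 0 0 = 3"
      by (simp add: psum_def)
    then have "psum x1 x2 x3 z1 z2 z3 0 0 \<in> ?A"
      by (simp add: alg_gen_closed)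
    moreover have "(a, b) \<in> {(0,0),(1,0),(2,0),(3,0),(0,1),(0,2),(0,3),(1,1),(2,1),(1,2)}"
    proof -
      have "a = 0 \<or> a = 1 \<or> a = 2 \<or> a = 3" "b = 0 \<or> b = 1 \<or> b = 2 \<or> b = 3"
        using False by linarith+
      then show ?thesis
        using False by (elim disjE) simp_all
    qed
    moreover have "psum x1 x2 x3 z1 z2 z3 1 0 \<in> ?A" "psum x1 x2 x3 z1 z2 z3 2 0 \<in> ?A"
      "psum x1 x2 x3 z1 z2 z3 3 0 \<in> ?A" "psum x1 x2 x3 z1 z2 z3 0 2 \<in> ?A"
      "psum x1 x2 x3 z1 z2 z3 0 4 \<in> ?A" "psum x1 x2 x3 z1 z2 z3 1 2 \<in> ?A"
      "psum x1 x2 x3 z1 z2 z3 2 2 \<in> ?A" "psum x1 x2 x3 z1 z2 z3 1 4 \<in> ?A"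
      using gen[of Tx] gen[of Tx2] gen[of Tx3] gen[of Ty] gen[of Ty2] gen[of Txy]
        gen[of Tx2y] gen[of Txy2] by (simp_all add: gen_at_def)
    ultimately show ?thesis
      using cube by (elim insertE emptyE) simp_all
  qed
qed

section \<open>The action of the symmetric group on four letters\<close>

lemma edge_cases:
  obtains "e = Abs_edge {1, 2}" | "e = Abs_edge {1, 3}" | "e = Abs_edge {1, 4}"
    | "e = Abs_edge {2, 3}" | "e = Abs_edge {2, 4}" | "e = Abs_edge {3, 4}"
proof -
  obtain i j where "Rep_edge e = {i, j}" "1 \<le> i" "i < j" "j \<le> (4 :: nat)"
    using Rep_edge[of e] by blast
  moreover from this have "e = Abs_edge {i, j}"
    using Rep_edge_inverse[of e] by simp
  moreover have "i \<in> {1, 2, 3}" "j \<in> {2, 3, 4}" "i < j"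
    using calculation by auto
  ultimately show ?thesis using that by auto
qed

lemma xe_commute: "xe i j = xe j i"
  by (simp add: xe_def insert_commute)

lemma xe_sorted:
  "xe 2 1 = xe 1 2" "xe 3 1 = xe 1 3" "xe 4 1 = xe 1 4"
  "xe 3 2 = xe 2 3" "xe 4 2 = xe 2 4" "xe 4 3 = xe 3 4"
  by (rule xe_commute)+

lemma S4_act_xe:
  assumes "i \<in> {1..4}" "j \<in> {1..4}" "i \<noteq> j"
  shows "S4_act \<sigma> (xe i j) = xe (\<sigma> i) (\<sigma> j)"
proof -
  have "{i, j} \<in> {{i, j} | i j :: nat. 1 \<le> i \<and> i < j \<and> j \<le> 4}"
    using assms by (cases "i < j") (fastforce simp: insert_commute)+
  then show ?thesis
    by (simp add: S4_act_def xe_def poly_subst_Var Abs_edge_inverse)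
qed

lemma S4_act_hom:
  "S4_act \<sigma> (p + q) = S4_act \<sigma> p + S4_act \<sigma> q" "S4_act \<sigma> (p - q) = S4_act \<sigma> p - S4_act \<sigma> q"
  "S4_act \<sigma> (p * q) = S4_act \<sigma> p * S4_act \<sigma> q" "S4_act \<sigma> (p ^ n) = S4_act \<sigma> p ^ n"
  "S4_act \<sigma> (- p) = - S4_act \<sigma> p" "S4_act \<sigma> (Const c) = Const c"
  "S4_act \<sigma> (numeral k) = numeral k" "S4_act \<sigma> 0 = 0" "S4_act \<sigma> 1 = 1"
  by (simp_all add: S4_act_def poly_subst_hom)

lemmas XZ_defs = X1_def X2_def X3_def Z1_def Z2_def Z3_def

lemma S4_act_XZ:
  "S4_act \<sigma> X1 = xe (\<sigma> 1) (\<sigma> 2) + xe (\<sigma> 3) (\<sigma> 4)"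
  "S4_act \<sigma> X2 = xe (\<sigma> 1) (\<sigma> 3) + xe (\<sigma> 2) (\<sigma> 4)"
  "S4_act \<sigma> X3 = xe (\<sigma> 1) (\<sigma> 4) + xe (\<sigma> 2) (\<sigma> 3)"
  "S4_act \<sigma> Z1 = xe (\<sigma> 1) (\<sigma> 2) - xe (\<sigma> 3) (\<sigma> 4)"
  "S4_act \<sigma> Z2 = xe (\<sigma> 1) (\<sigma> 3) - xe (\<sigma> 2) (\<sigma> 4)"
  "S4_act \<sigma> Z3 = xe (\<sigma> 1) (\<sigma> 4) - xe (\<sigma> 2) (\<sigma> 3)"
  by (simp_all add: XZ_defs S4_act_hom S4_act_xe)

lemma alg_gen_XZ:
  assumes "(2 :: 'k::field) \<noteq> 0"
  shows "alg_gen {X1, X2, X3, Z1, Z2, Z3} = (UNIV :: 'k R_poly set)"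
proof -
  have half: "p \<in> alg_gen B" if "2 * p \<in> alg_gen B" for p :: "'k R_poly" and B
    using that assms by (rule alg_gen_divide_numeral)
  have "Var e \<in> alg_gen {X1, X2, X3, Z1, Z2, Z3 :: 'k R_poly}" (is "_ \<in> ?A") for e
  proof -
    have "2 * xe 1 2 = X1 + (Z1 :: 'k R_poly)" "2 * xe 3 4 = X1 - (Z1 :: 'k R_poly)"
      "2 * xe 1 3 = X2 + (Z2 :: 'k R_poly)" "2 * xe 2 4 = X2 - (Z2 :: 'k R_poly)"
      "2 * xe 1 4 = X3 + (Z3 :: 'k R_poly)" "2 * xe 2 3 = X3 - (Z3 :: 'k R_poly)"
      by (simp_all add: XZ_defs)
    then have "2 * xe 1 2 \<in> ?A" "2 * xe 3 4 \<in> ?A" "2 * xe 1 3 \<in> ?A"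
      "2 * xe 2 4 \<in> ?A" "2 * xe 1 4 \<in> ?A" "2 * xe 2 3 \<in> ?A"
      by (auto intro: alg_gen_closed alg_gen_base)
    then have "xe 1 2 \<in> ?A" "xe 3 4 \<in> ?A" "xe 1 3 \<in> ?A" "xe 2 4 \<in> ?A" "xe 1 4 \<in> ?A" "xe 2 3 \<in> ?A"
      by (auto intro: half)
    then show ?thesis
      by (cases e rule: edge_cases) (simp_all add: xe_def)
  qed
  then have "p \<in> ?A" for p :: "'k R_poly"
    by (induction p rule: mpoly_induct) (auto intro: alg_gen_closed)
  then show ?thesis by blast
qed

lemma subalgebra_R_S4: "subalgebra R_S4"
  by (auto simp: subalgebra_def R_S4_def S4_act_def poly_subst_hom)

lemma S4_act_comp:
  assumes "\<tau> permutes {1..4}"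
  shows "S4_act (\<sigma> \<circ> \<tau>) p = S4_act \<sigma> (S4_act \<tau> p)"
proof -
  have "S4_act (\<sigma> \<circ> \<tau>) (xe i j) = S4_act \<sigma> (S4_act \<tau> (xe i j :: 'a R_poly))"
    if ij: "i \<in> {1..4}" "j \<in> {1..4}" "i \<noteq> j" for i j
  proof -
    have "\<tau> i \<in> {1..4}" "\<tau> j \<in> {1..4}" "\<tau> i \<noteq> \<tau> j"
      using ij assms permutes_in_image[OF assms] permutes_inj[OF assms] by (simp_all add: inj_eq)
    then show ?thesis using ij by (simp add: S4_act_xe)
  qed
  note on_xe = this
  have "S4_act (\<sigma> \<circ> \<tau>) (Var e) = S4_act \<sigma> (S4_act \<tau> (Var e :: 'a R_poly))" for e
    by (cases e rule: edge_cases) (simp_all add: on_xe flip: xe_def)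
  then show ?thesis
    by (induction p rule: mpoly_induct) (simp_all add: S4_act_hom)
qed

text \<open>The transpositions generate the symmetric group.\<close>

lemma in_R_S4I:
  assumes "\<And>a b. a \<in> {1..4} \<Longrightarrow> b \<in> {1..4} \<Longrightarrow> a < b \<Longrightarrow> S4_act (Transposition.transpose a b) p = p"
  shows "p \<in> R_S4"
proof -
  have "S4_act \<sigma> p = p" if "\<sigma> permutes {1..4}" for \<sigma>
    using that finite_atLeastAtMost[of 1 "4 :: nat"]
  proof (induction \<sigma> rule: permutes_induct)
    case id
    show ?case
      by (induction p rule: mpoly_induct)
        (simp_all add: S4_act_hom, simp add: S4_act_def poly_subst_Var Rep_edge_inverse)
  next
    case (swap a b \<sigma>)
    then have "S4_act (Transposition.transpose a b) p = p"
      using assms[of a b] assms[of b a] by (cases "a < b") (auto simp: transpose_commute)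
    with swap show ?case by (subst S4_act_comp) simp_all
  qed
  then show ?thesis by (simp add: R_S4_def)
qed

lemma gen_at_sym:
  "gen_at x1 x3 x2 z1 z3 z2 v = gen_at x1 x2 x3 z1 z2 z3 v"
  "gen_at x3 x2 x1 z3 z2 z1 v = gen_at x1 x2 x3 z1 z2 z3 v"
  "gen_at x2 x1 x3 z2 z1 z3 v = gen_at x1 x2 x3 z1 z2 z3 v"
  "gen_at x1 x3 x2 z1 (- z3) (- z2) v = gen_at x1 x2 x3 z1 z2 z3 v"
  "gen_at x3 x2 x1 (- z3) z2 (- z1) v = gen_at x1 x2 x3 z1 z2 z3 v"
  "gen_at x2 x1 x3 (- z2) (- z1) z3 v = gen_at x1 x2 x3 z1 z2 z3 v"
  by (cases v; simp add: gen_at_def psum_def add_ac mult_ac)+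

text \<open>The transpositions that fix the letter 1 permute the pairs \<open>(X\<^sub>i, Z\<^sub>i)\<close>; those that move it also
  change two signs.\<close>

lemma S4_act_transpose:
  "S4_act (Transposition.transpose 1 2) X1 = X1" "S4_act (Transposition.transpose 1 2) X2 = X3"
  "S4_act (Transposition.transpose 1 2) X3 = X2" "S4_act (Transposition.transpose 1 2) Z1 = Z1"
  "S4_act (Transposition.transpose 1 2) Z2 = - Z3" "S4_act (Transposition.transpose 1 2) Z3 = - Z2"
  "S4_act (Transposition.transpose 1 3) X1 = X3" "S4_act (Transposition.transpose 1 3) X2 = X2"
  "S4_act (Transposition.transpose 1 3) X3 = X1" "S4_act (Transposition.transpose 1 3) Z1 = - Z3"
  "S4_act (Transposition.transpose 1 3) Z2 = Z2" "S4_act (Transposition.transpose 1 3) Z3 = - Z1"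
  "S4_act (Transposition.transpose 1 4) X1 = X2" "S4_act (Transposition.transpose 1 4) X2 = X1"
  "S4_act (Transposition.transpose 1 4) X3 = X3" "S4_act (Transposition.transpose 1 4) Z1 = - Z2"
  "S4_act (Transposition.transpose 1 4) Z2 = - Z1" "S4_act (Transposition.transpose 1 4) Z3 = Z3"
  "S4_act (Transposition.transpose 2 3) X1 = X2" "S4_act (Transposition.transpose 2 3) X2 = X1"
  "S4_act (Transposition.transpose 2 3) X3 = X3" "S4_act (Transposition.transpose 2 3) Z1 = Z2"
  "S4_act (Transposition.transpose 2 3) Z2 = Z1" "S4_act (Transposition.transpose 2 3) Z3 = Z3"
  "S4_act (Transposition.transpose 2 4) X1 = X3" "S4_act (Transposition.transpose 2 4) X2 = X2"
  "S4_act (Transposition.transpose 2 4) X3 = X1" "S4_act (Transposition.transpose 2 4) Z1 = Z3"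
  "S4_act (Transposition.transpose 2 4) Z2 = Z2" "S4_act (Transposition.transpose 2 4) Z3 = Z1"
  "S4_act (Transposition.transpose 3 4) X1 = X1" "S4_act (Transposition.transpose 3 4) X2 = X3"
  "S4_act (Transposition.transpose 3 4) X3 = X2" "S4_act (Transposition.transpose 3 4) Z1 = Z1"
  "S4_act (Transposition.transpose 3 4) Z2 = Z3" "S4_act (Transposition.transpose 3 4) Z3 = Z2"
  by (simp_all only: S4_act_XZ)
     (simp_all add: XZ_defs transpose_def xe_sorted add.commute del: One_nat_def)

lemma gen_at_XZ_in_R_S4: "gen_at X1 X2 X3 Z1 Z2 Z3 v \<in> R_S4"
proof (rule in_R_S4I)
  fix a b :: nat assume "a \<in> {1..4}" "b \<in> {1..4}" "a < b"
  then have ab: "(a, b) \<in> {(1,2), (1,3), (1,4), (2,3), (2,4), (3,4)}" by auto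
  have act: "S4_act \<sigma> (gen_at X1 X2 X3 Z1 Z2 Z3 v) =
      gen_at (S4_act \<sigma> X1) (S4_act \<sigma> X2) (S4_act \<sigma> X3)
             (S4_act \<sigma> Z1) (S4_act \<sigma> Z2) (S4_act \<sigma> Z3 :: 'a R_poly) v" for \<sigma>
    by (simp add: S4_act_def poly_subst_gen_at)
  show "S4_act (Transposition.transpose a b) (gen_at X1 X2 X3 Z1 Z2 Z3 v) =
      (gen_at X1 X2 X3 Z1 Z2 Z3 v :: 'a R_poly)"
    using ab unfolding act
    by (elim insertE emptyE)
       (simp_all only: prod.inject, elim conjE, simp_all only: S4_act_transpose gen_at_sym(4-6),
        simp_all only: gen_at_sym(1)[of X1 X3 X2 Z1 Z3 Z2] gen_at_sym(2)[of X3 X2 X1 Z3 Z2 Z1]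
          gen_at_sym(3)[of X2 X1 X3 Z2 Z1 Z3])
qed

section \<open>Generators of the invariant algebra\<close>

lemma prod_powers_eq_monomial:
  assumes "finite V" "f ` V \<subseteq> {x1, x2, x3, z1, z2, z3 :: 'r::comm_ring_1}"
  shows "\<exists>a1 a2 a3 b1 b2 b3. (\<Prod>v\<in>V. f v ^ n v) =
    x1 ^ a1 * z1 ^ b1 * (x2 ^ a2 * z2 ^ b2) * (x3 ^ a3 * z3 ^ b3)"
  using assms
proof (induction V rule: finite_induct)
  case empty
  show ?case by (intro exI[of _ 0]) simp
next
  case (insert v V)
  then obtain a1 a2 a3 b1 b2 b3 where eq: "(\<Prod>v\<in>V. f v ^ n v) =
      x1 ^ a1 * z1 ^ b1 * (x2 ^ a2 * z2 ^ b2) * (x3 ^ a3 * z3 ^ b3)" by auto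
  let ?k = "n v"
  have prod: "(\<Prod>v\<in>insert v V. f v ^ n v) =
      f v ^ ?k * (x1 ^ a1 * z1 ^ b1 * (x2 ^ a2 * z2 ^ b2) * (x3 ^ a3 * z3 ^ b3))"
    using insert.hyps eq by simp
  consider "f v = x1" | "f v = x2" | "f v = x3" | "f v = z1" | "f v = z2" | "f v = z3"
    using insert.prems by auto
  then show ?case
  proof cases
    case 1
    then have "(\<Prod>v\<in>insert v V. f v ^ n v) =
        x1 ^ (a1 + ?k) * z1 ^ b1 * (x2 ^ a2 * z2 ^ b2) * (x3 ^ a3 * z3 ^ b3)"
      by (simp only: prod power_add mult_ac)
    then show ?thesis by blast
  next
    case 2
    then have "(\<Prod>v\<in>insert v V. f v ^ n v) =
        x1 ^ a1 * z1 ^ b1 * (x2 ^ (a2 + ?k) * z2 ^ b2) * (x3 ^ a3 * z3 ^ b3)"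
      by (simp only: prod power_add mult_ac)
    then show ?thesis by blast
  next
    case 3
    then have "(\<Prod>v\<in>insert v V. f v ^ n v) =
        x1 ^ a1 * z1 ^ b1 * (x2 ^ a2 * z2 ^ b2) * (x3 ^ (a3 + ?k) * z3 ^ b3)"
      by (simp only: prod power_add mult_ac)
    then show ?thesis by blast
  next
    case 4
    then have "(\<Prod>v\<in>insert v V. f v ^ n v) =
        x1 ^ a1 * z1 ^ (b1 + ?k) * (x2 ^ a2 * z2 ^ b2) * (x3 ^ a3 * z3 ^ b3)"
      by (simp only: prod power_add mult_ac)
    then show ?thesis by blast
  next
    case 5
    then have "(\<Prod>v\<in>insert v V. f v ^ n v) =
        x1 ^ a1 * z1 ^ b1 * (x2 ^ a2 * z2 ^ (b2 + ?k)) * (x3 ^ a3 * z3 ^ b3)"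
      by (simp only: prod power_add mult_ac)
    then show ?thesis by blast
  next
    case 6
    then have "(\<Prod>v\<in>insert v V. f v ^ n v) =
        x1 ^ a1 * z1 ^ b1 * (x2 ^ a2 * z2 ^ b2) * (x3 ^ a3 * z3 ^ (b3 + ?k))"
      by (simp only: prod power_add mult_ac)
    then show ?thesis by blast
  qed
qed

text \<open>As the generated algebra is spanned by monomials, additive statements need a proof for
  monomials only.\<close>

lemma alg_gen_monomial_induct [consumes 1, case_names zero monomial add]:
  fixes x1 x2 x3 z1 z2 z3 :: "('v, 'k::field) mpoly"
  assumes "p \<in> alg_gen {x1, x2, x3, z1, z2, z3}"
    and zero: "P 0"
    and monomial: "\<And>c a1 a2 a3 b1 b2 b3.
      P (Const c * (x1 ^ a1 * z1 ^ b1 * (x2 ^ a2 * z2 ^ b2) * (x3 ^ a3 * z3 ^ b3)))"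
    and add: "\<And>p q. P p \<Longrightarrow> P q \<Longrightarrow> P (p + q)"
  shows "P p"
proof -
  let ?G = "{x1, x2, x3, z1, z2, z3}"
  \<comment> \<open>the six generators serve as the variables of the polynomials that are substituted into\<close>
  define f where "f v = (if v \<in> ?G then v else x1)" for v
  have "range f = ?G"
    by (auto simp: f_def image_iff)
  with assms(1) obtain q where q: "p = poly_subst f q"
    using range_poly_subst[of f] by auto
  have "P (\<Sum>m\<in>M. Const (Poly_Mapping.lookup q m) *
      (\<Prod>v\<in>Poly_Mapping.keys m. f v ^ Poly_Mapping.lookup m v))" if "finite M" for M
    using that
  proof (induction M rule: finite_induct)
    case (insert m M)
    have "f ` Poly_Mapping.keys m \<subseteq> ?G"
      unfolding \<open>range f = ?G\<close>[symmetric] by blast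
    from prod_powers_eq_monomial[OF finite_keys this, of "Poly_Mapping.lookup m"]
    obtain a1 a2 a3 b1 b2 b3 where "(\<Prod>v\<in>Poly_Mapping.keys m. f v ^ Poly_Mapping.lookup m v) =
        x1 ^ a1 * z1 ^ b1 * (x2 ^ a2 * z2 ^ b2) * (x3 ^ a3 * z3 ^ b3)"
      by blast
    with insert show ?case by (simp add: add monomial)
  qed (simp add: zero)
  from this[of "Poly_Mapping.keys q"] show ?thesis
    by (simp add: q poly_subst_def)
qed

text \<open>The group \<open>S\<^sub>4\<close> is the product of its normal Klein four-group and the stabilizer of the letter 1.
  The sum over the group is therefore taken in these two steps, each written with
  transpositions.\<close>

definition klein_sum :: "'k::field R_poly \<Rightarrow> 'k R_poly" where
  "klein_sum p = p
     + S4_act (Transposition.transpose 1 2) (S4_act (Transposition.transpose 3 4) p)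
     + S4_act (Transposition.transpose 1 3) (S4_act (Transposition.transpose 2 4) p)
     + S4_act (Transposition.transpose 1 4) (S4_act (Transposition.transpose 2 3) p)"

definition stabilizer_sum :: "'k::field R_poly \<Rightarrow> 'k R_poly" where
  "stabilizer_sum p = p
     + S4_act (Transposition.transpose 3 4) p
     + S4_act (Transposition.transpose 2 3) p
     + S4_act (Transposition.transpose 3 4) (S4_act (Transposition.transpose 2 3) p)
     + S4_act (Transposition.transpose 2 3) (S4_act (Transposition.transpose 3 4) p)
     + S4_act (Transposition.transpose 2 4) p"

text \<open>The Klein four-group changes the signs of two of the \<open>Z\<^sub>i\<close>; a monomial survives the sum exactly if
  its three exponents of the \<open>Z\<^sub>i\<close> have the same parity.\<close>

lemma klein_sum_monomial:
  fixes c :: "'k::field"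
  defines "m a1 a2 a3 b1 b2 b3 \<equiv> Const c * (X1 ^ a1 * Z1 ^ b1 * (X2 ^ a2 * Z2 ^ b2) * (X3 ^ a3 * Z3 ^ b3))"
  shows "klein_sum (m a1 a2 a3 b1 b2 b3) =
    (if even b1 = even b2 \<and> even b2 = even b3 then 4 * m a1 a2 a3 b1 b2 b3 else 0)"
proof -
  have parity: "(- z) ^ b = (if even b then z ^ b else - (z ^ b))" for z :: "'k R_poly" and b
    by simp
  show ?thesis
    by (simp add: klein_sum_def m_def S4_act_hom S4_act_transpose parity del: One_nat_def)
qed

lemma stabilizer_sum_monomial:
  fixes c :: "'k::field"
  assumes char: "(2 :: 'k) \<noteq> 0" "(3 :: 'k) \<noteq> 0"
  shows "stabilizer_sum (Const c * (Z1 * Z2 * Z3) ^ e *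
      (X1 ^ a1 * Z1 ^ (2 * b1) * (X2 ^ a2 * Z2 ^ (2 * b2)) * (X3 ^ a3 * Z3 ^ (2 * b3))))
    \<in> alg_gen (range (gen_at X1 X2 X3 Z1 Z2 Z3))" (is "stabilizer_sum ?m \<in> ?A")
proof -
  define q :: "nat \<Rightarrow> nat \<Rightarrow> 'k R_poly" where "q a b = psum X1 X2 X3 Z1 Z2 Z3 a (2 * b)" for a b
  have q: "q a b \<in> ?A" for a b
    unfolding q_def by (rule psum_in_alg_gen[OF char])
  have "gen_at X1 X2 X3 Z1 Z2 Z3 TS \<in> ?A"
    by (rule alg_gen_base) simp
  then have Z: "Z1 * Z2 * Z3 \<in> ?A"
    by (simp add: gen_at_def)
  have rot: "Z3 * Z1 * Z2 = Z1 * Z2 * Z3" "Z2 * Z3 * Z1 = Z1 * Z2 * Z3" "Z2 * Z1 * Z3 = Z1 * Z2 * Z3"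
    "Z1 * Z3 * Z2 = Z1 * Z2 * Z3" "Z3 * Z2 * Z1 = Z1 * Z2 * (Z3 :: 'k R_poly)"
    by (simp_all add: mult_ac)
  have "stabilizer_sum ?m = Const c * (Z1 * Z2 * Z3) ^ e *
     (q a1 b1 * q a2 b2 * q a3 b3 - q (a1+a2) (b1+b2) * q a3 b3 - q (a1+a3) (b1+b3) * q a2 b2
      - q (a2+a3) (b2+b3) * q a1 b1 + 2 * q (a1+a2+a3) (b1+b2+b3))"
    unfolding q_def distrib_left[of 2] psum_product_sum[symmetric]
    unfolding stabilizer_sum_def S4_act_hom S4_act_transpose rot
    by (simp only: distrib_left)
  also have "\<dots> \<in> ?A"
    by (intro alg_gen_closed Z q)
  finally show ?thesis .
qed

text \<open>An invariant is, up to the factor 24, its own sum over the group, so it suffices to sum the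
  monomials over the group.\<close>

lemma R_S4_eq:
  assumes char: "(2 :: 'k::field) \<noteq> 0" "(3 :: 'k) \<noteq> 0"
  shows "(R_S4 :: 'k R_poly set) = alg_gen (range (gen_at X1 X2 X3 Z1 Z2 Z3))" (is "_ = ?A")
proof
  show "?A \<subseteq> R_S4"
    using gen_at_XZ_in_R_S4 by (intro alg_gen_minimal subalgebra_R_S4) blast
  have average: "stabilizer_sum (klein_sum p) \<in> ?A" for p :: "'k R_poly"
  proof -
    have add: "stabilizer_sum (p + q) = stabilizer_sum p + stabilizer_sum q"
      "klein_sum (p + q) = klein_sum p + klein_sum q" for p q :: "'k R_poly"
      by (simp_all add: stabilizer_sum_def klein_sum_def S4_act_hom add_ac)
    have zero: "stabilizer_sum 0 = (0 :: 'k R_poly)" "klein_sum 0 = (0 :: 'k R_poly)"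
      by (simp_all add: stabilizer_sum_def klein_sum_def S4_act_hom)
    have "p \<in> alg_gen {X1, X2, X3, Z1, Z2, Z3}"
      using alg_gen_XZ[OF char(1)] by simp
    then show ?thesis
    proof (induction p rule: alg_gen_monomial_induct)
      case (monomial c a1 a2 a3 b1 b2 b3)
      consider "even b1" "even b2" "even b3" | "odd b1" "odd b2" "odd b3"
        | "\<not> (even b1 = even b2 \<and> even b2 = even b3)" by blast
      then show ?case
      proof cases
        case 1
        then obtain k1 k2 k3 where k: "b1 = 2 * k1" "b2 = 2 * k2" "b3 = 2 * k3"
          by (auto elim!: evenE)
        have "4 * Const c = (Const (4 * c) :: 'k R_poly)" by (simp add: Const_mult Const_numeral)
        then show ?thesis
          using stabilizer_sum_monomial[OF char, of "4 * c" 0 a1 k1 a2 k2 a3 k3]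
          by (simp add: klein_sum_monomial k mult.assoc[symmetric, of 4])
      next
        case 2
        then obtain k1 k2 k3 where k: "b1 = 2 * k1 + 1" "b2 = 2 * k2 + 1" "b3 = 2 * k3 + 1"
          by (auto elim!: oddE)
        have "4 * (Const c * (X1 ^ a1 * Z1 ^ b1 * (X2 ^ a2 * Z2 ^ b2) * (X3 ^ a3 * Z3 ^ b3))) =
            Const (4 * c) * (Z1 * Z2 * Z3) ^ 1 *
              (X1 ^ a1 * Z1 ^ (2 * k1) * (X2 ^ a2 * Z2 ^ (2 * k2)) * (X3 ^ a3 * Z3 ^ (2 * k3)))"
          by (simp add: k Const_mult Const_numeral mult_ac)
        then show ?thesis
          using 2 stabilizer_sum_monomial[OF char, of "4 * c" 1 a1 k1 a2 k2 a3 k3]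
          by (simp only: klein_sum_monomial if_True simp_thms)
      next
        case 3
        then show ?thesis by (simp only: klein_sum_monomial if_False zero alg_gen_0)
      qed
    qed (simp_all add: add zero alg_gen_closed)
  qed
  show "R_S4 \<subseteq> ?A"
  proof
    fix p :: "'k R_poly" assume "p \<in> R_S4"
    then have fixed: "S4_act (Transposition.transpose a b) p = p" if "a \<in> {1..4}" "b \<in> {1..4}" for a b
      using that by (simp add: R_S4_def permutes_swap_id)
    have fixed': "klein_sum p = 4 * p" "stabilizer_sum p = 6 * p"
      by (simp_all add: klein_sum_def stabilizer_sum_def fixed)
    have "stabilizer_sum (4 * p) = 4 * stabilizer_sum p"
      by (simp add: stabilizer_sum_def S4_act_hom algebra_simps)
    then have "2 * (2 * (2 * (3 * p))) \<in> ?A"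
      using average[of p] by (simp add: fixed' flip: mult.assoc)
    from this[THEN alg_gen_divide_numeral, OF char(1), THEN alg_gen_divide_numeral, OF char(1),
        THEN alg_gen_divide_numeral, OF char(1), THEN alg_gen_divide_numeral, OF char(2)]
    show "p \<in> ?A" .
  qed
qed

lemma range_phi1:
  assumes char: "(2 :: 'k::field) \<noteq> 0" "(3 :: 'k) \<noteq> 0"
  shows "range phi1 = (R_S4 :: 'k R_poly set)"
  using R_S4_eq[OF char] by (simp add: phi1_eq range_poly_subst)

section \<open>The relations\<close>

text \<open>Extends a point of the nine-dimensional space of \<open>F\<^sub>1\<close> by the value of \<open>Ty3\<close> that the substitution
  \<open>tilde\<close> prescribes.\<close>

definition tilde_at :: "(f1_var \<Rightarrow> ('v, 'k::field) mpoly) \<Rightarrow> f_var \<Rightarrow> ('v, 'k) mpoly" where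
  "tilde_at g v = (case v of In u \<Rightarrow> g u
     | Ty3 \<Rightarrow> 3 * g TS ^ 2 + Const (3 / 2) * g Ty2 * g Ty - Const (1 / 2) * g Ty ^ 3)"

lemma tilde_eq: "tilde = poly_subst (tilde_at Var)"
  unfolding tilde_def tilde_at_def ..

lemma poly_subst_tilde: "poly_subst g (tilde p) = poly_subst (tilde_at g) p"
proof -
  have "poly_subst g (tilde_at Var v) = tilde_at g v" for v
    by (simp add: tilde_at_def poly_subst_hom split: f_var.split)
  then show ?thesis unfolding tilde_eq poly_subst_comp by simp
qed

definition relations :: "'k::field f1_poly list" where
  "relations = [tilde J32, tilde J23, tilde J42, tilde J33, tilde J24]"

text \<open>The prescribed value of \<open>Ty3\<close> is the power sum \<open>[z\<^sup>6]\<close>, so the relations become identities between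
  the power sums of three points.\<close>

lemma tilde_at_gen_at:
  assumes "(2 :: 'k) \<noteq> 0"
  shows "tilde_at (gen_at x1 x2 x3 z1 z2 z3) Ty3 = (psum x1 x2 x3 z1 z2 z3 0 6 :: ('v, 'k::field) mpoly)"
proof -
  let ?p = "psum x1 x2 x3 z1 z2 z3"
  have "?p 0 6 = Const (1 / 2) * (2 * ?p 0 6)"
    using assms by (simp add: Const_inverse_numeral_mult)
  also have "\<dots> = Const (1 / 2) * (2 * (3 * (z1 * z2 * z3)\<^sup>2)) + Const (1 / 2) * 3 * ?p 0 4 * ?p 0 2
      - Const (1 / 2) * ?p 0 2 ^ 3"
    unfolding psum_0_6 by (simp add: algebra_simps)
  also have "Const (1 / 2) * 3 = (Const (3 / 2) :: ('v, 'k) mpoly)"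
    by (simp flip: Const_numeral Const_mult)
  also have "Const (1 / 2) * (2 * (3 * (z1 * z2 * z3)\<^sup>2)) = 3 * (z1 * z2 * z3)\<^sup>2"
    by (rule Const_inverse_numeral_mult[OF assms])
  finally show ?thesis
    by (simp add: tilde_at_def gen_at_def)
qed

lemma gen_at_values:
  fixes x1 x2 x3 z1 z2 z3 :: "'r::comm_ring_1"
  shows "gen_at x1 x2 x3 z1 z2 z3 Tx = x1 + x2 + x3"
    "gen_at x1 x2 x3 z1 z2 z3 Tx2 = x1^2 + x2^2 + x3^2"
    "gen_at x1 x2 x3 z1 z2 z3 Tx3 = x1^3 + x2^3 + x3^3"
    "gen_at x1 x2 x3 z1 z2 z3 Ty = z1^2 + z2^2 + z3^2"
    "gen_at x1 x2 x3 z1 z2 z3 Ty2 = (z1^2)^2 + (z2^2)^2 + (z3^2)^2"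
    "gen_at x1 x2 x3 z1 z2 z3 Txy = x1 * z1^2 + x2 * z2^2 + x3 * z3^2"
    "gen_at x1 x2 x3 z1 z2 z3 Tx2y = x1^2 * z1^2 + x2^2 * z2^2 + x3^2 * z3^2"
    "gen_at x1 x2 x3 z1 z2 z3 Txy2 = x1 * (z1^2)^2 + x2 * (z2^2)^2 + x3 * (z3^2)^2"
    "gen_at x1 x2 x3 z1 z2 z3 TS = z1 * z2 * z3"
  by (simp_all add: gen_at_def psum_def flip: power_mult)

lemma relations_vanish_at:
  fixes x1 x2 x3 z1 z2 z3 :: "('v::linorder, 'k::field) mpoly"
  assumes "(2 :: 'k) \<noteq> 0" "r \<in> set relations"
  shows "poly_subst (gen_at x1 x2 x3 z1 z2 z3) r = 0"
proof -
  let ?f = "tilde_at (gen_at x1 x2 x3 z1 z2 z3)"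
  have var: "?f (In v) = gen_at x1 x2 x3 z1 z2 z3 v" for v
    by (simp add: tilde_at_def)
  have y3: "?f Ty3 = (z1^2)^3 + (z2^2)^3 + (z3^2)^3"
    unfolding tilde_at_gen_at[OF assms(1)] by (simp add: psum_def flip: power_mult)
  note eval = poly_subst_hom var y3 gen_at_values
  have "poly_subst ?f J32 = 0" "poly_subst ?f J23 = 0"
    unfolding J32_def J23_def eval by algebra+
  moreover have "poly_subst ?f J42 = 0" unfolding J42_def eval by algebra
  moreover have "poly_subst ?f J33 = 0" unfolding J33_def eval by algebra
  moreover have "poly_subst ?f J24 = 0" unfolding J24_def eval by algebra
  ultimately show ?thesis
    using assms(2) by (auto simp: relations_def poly_subst_tilde)
qed

text \<open>The map \<open>phi1\<close> in six independent coordinates \<open>x\<^sub>i\<close>, \<open>z\<^sub>i\<close>, numbered from 0 to 5. Every evaluation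
  at a point factors through it, and its target is an integral domain because the variables are
  linearly ordered.\<close>

definition phi_coord :: "'k::field f1_poly \<Rightarrow> (nat, 'k) mpoly" where
  "phi_coord = poly_subst (gen_at (Var 0) (Var 1) (Var 2) (Var 3) (Var 4) (Var 5))"

lemma poly_subst_gen_at_eq_phi_coord:
  "poly_subst (gen_at x1 x2 x3 z1 z2 z3) p =
     poly_subst (\<lambda>i. [x1, x2, x3, z1, z2, z3] ! i) (phi_coord p)"
  unfolding phi_coord_def poly_subst_comp_gen_at by (simp add: poly_subst_Var)

text \<open>As 2 is invertible, the \<open>X\<^sub>i\<close> and \<open>Z\<^sub>i\<close> are coordinates of \<open>R\<close>: the edge variables are
  \<open>(x\<^sub>i \<plusminus> z\<^sub>i) / 2\<close>.\<close>

lemma phi1_eq_0_iff: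
  assumes "(2 :: 'k::field) \<noteq> 0"
  shows "phi1 (p :: 'k f1_poly) = 0 \<longleftrightarrow> phi_coord p = 0"
proof
  assume "phi_coord p = 0"
  then show "phi1 p = 0"
    unfolding phi1_eq poly_subst_gen_at_eq_phi_coord by (simp add: poly_subst_0)
next
  assume p: "phi1 p = 0"
  define f :: "edge \<Rightarrow> (nat, 'k) mpoly" where "f e = Const (1 / 2) *
     (if Rep_edge e = {1, 2} then Var 0 + Var 3 else if Rep_edge e = {3, 4} then Var 0 - Var 3
      else if Rep_edge e = {1, 3} then Var 1 + Var 4 else if Rep_edge e = {2, 4} then Var 1 - Var 4
      else if Rep_edge e = {1, 4} then Var 2 + Var 5 else Var 2 - Var 5)" for e
  have rep: "Rep_edge (Abs_edge {i, j}) = {i, j}" if "1 \<le> i" "i < j" "j \<le> 4" for i j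
    using that by (intro Abs_edge_inverse) blast
  have "Const (1 / 2) * (a + b) + Const (1 / 2) * (a - b) = (a :: (nat, 'k) mpoly)"
    "Const (1 / 2) * (a + b) - Const (1 / 2) * (a - b) = (b :: (nat, 'k) mpoly)" for a b
    using Const_inverse_numeral_mult[OF assms, of a] Const_inverse_numeral_mult[OF assms, of b]
    by (simp_all flip: distrib_left right_diff_distrib)
  moreover have "poly_subst f (xe 1 2) = Const (1 / 2) * (Var 0 + Var 3)"
    "poly_subst f (xe 3 4) = Const (1 / 2) * (Var 0 - Var 3)"
    "poly_subst f (xe 1 3) = Const (1 / 2) * (Var 1 + Var 4)"
    "poly_subst f (xe 2 4) = Const (1 / 2) * (Var 1 - Var 4)"
    "poly_subst f (xe 1 4) = Const (1 / 2) * (Var 2 + Var 5)"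
    "poly_subst f (xe 2 3) = Const (1 / 2) * (Var 2 - Var 5)"
    by (simp_all add: xe_def poly_subst_Var f_def rep doubleton_eq_iff)
  ultimately have "poly_subst f X1 = Var 0" "poly_subst f X2 = Var 1" "poly_subst f X3 = Var 2"
    "poly_subst f Z1 = Var 3" "poly_subst f Z2 = Var 4" "poly_subst f Z3 = Var 5"
    by (simp_all only: XZ_defs poly_subst_hom)
  then have "phi_coord p = poly_subst f (phi1 p)"
    unfolding phi1_eq phi_coord_def poly_subst_comp_gen_at by simp
  with p show "phi_coord p = 0" by (simp add: poly_subst_0)
qed

lemma phi1_ideal_relations:
  assumes "(2 :: 'k::field) \<noteq> 0" "p \<in> ideal_gen (set relations)"
  shows "phi1 (p :: 'k f1_poly) = 0"
  unfolding phi1_eq_0_iff[OF assms(1)] using assms(2)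
  unfolding phi_coord_def
  by (rule poly_subst_ideal_gen_eq_0) (rule relations_vanish_at[OF assms(1)])

section \<open>Normal forms modulo the relations\<close>

text \<open>The subring of coefficients of the normal forms: its generators are mapped to a homogeneous
  system of parameters of the invariant algebra.\<close>

definition prim :: "'k::field f1_poly set" where
  "prim = alg_gen (Var ` {Tx, Tx2, Tx3, Ty, Ty2, TS})"

text \<open>The submodule over \<open>prim\<close> that is generated by \<open>B\<close> together with the ideal of the relations.\<close>

inductive_set nf_span :: "'k::field f1_poly set \<Rightarrow> 'k f1_poly set" for B where
  ideal: "p \<in> ideal_gen (set relations) \<Longrightarrow> p \<in> nf_span B"
| scaled: "c \<in> prim \<Longrightarrow> b \<in> B \<Longrightarrow> c * b \<in> nf_span B"
| add: "p \<in> nf_span B \<Longrightarrow> q \<in> nf_span B \<Longrightarrow> p + q \<in> nf_span B"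

lemma prim_closed:
  "Var Tx \<in> prim" "Var Tx2 \<in> prim" "Var Tx3 \<in> prim" "Var Ty \<in> prim" "Var Ty2 \<in> prim"
  "Var TS \<in> prim" "0 \<in> prim" "1 \<in> prim" "numeral n \<in> prim" "Const a \<in> prim"
  "p \<in> prim \<Longrightarrow> q \<in> prim \<Longrightarrow> p + q \<in> prim" "p \<in> prim \<Longrightarrow> q \<in> prim \<Longrightarrow> p * q \<in> prim"
  "p \<in> prim \<Longrightarrow> q \<in> prim \<Longrightarrow> p - q \<in> prim" "p \<in> prim \<Longrightarrow> - p \<in> prim"
  "p \<in> prim \<Longrightarrow> p ^ k \<in> prim"
  by (auto simp: prim_def intro: alg_gen_closed alg_gen_base)

lemma nf_span_mult:
  assumes "p \<in> nf_span B" "\<And>b. b \<in> B \<Longrightarrow> t * b \<in> nf_span C"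
    and scale: "\<And>c q. c \<in> prim \<Longrightarrow> q \<in> nf_span C \<Longrightarrow> c * q \<in> nf_span C"
  shows "t * p \<in> nf_span C"
  using assms(1)
proof (induction rule: nf_span.induct)
  case (ideal p)
  then show ?case by (intro nf_span.ideal ideal_gen_mult)
next
  case (scaled c b)
  then have "c * (t * b) \<in> nf_span C" by (intro scale assms(2))
  then show ?case by (simp add: mult_ac)
next
  case (add p q)
  then show ?case by (simp add: distrib_left nf_span.add)
qed

lemma nf_span_prim_mult: "c \<in> prim \<Longrightarrow> p \<in> nf_span B \<Longrightarrow> c * p \<in> nf_span B"
proof (rotate_tac, induction rule: nf_span.induct)
  case (ideal p)
  then show ?case by (intro nf_span.ideal ideal_gen_mult)
next
  case (scaled d b)
  then show ?case by (simp add: nf_span.scaled prim_closed flip: mult.assoc)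
next
  case (add p q)
  then show ?case by (simp add: distrib_left nf_span.add)
qed

lemmas nf_span_mult_closed = nf_span_mult[OF _ _ nf_span_prim_mult]

lemma nf_span_base: "b \<in> B \<Longrightarrow> b \<in> nf_span B"
  using nf_span.scaled[OF prim_closed(8)] by simp

lemma nf_span_mono: "B \<subseteq> C \<Longrightarrow> p \<in> nf_span B \<Longrightarrow> p \<in> nf_span C"
  by (rotate_tac, induction rule: nf_span.induct) (auto intro: nf_span.intros)

lemma nf_span_divide_numeral:
  "p \<in> nf_span B" if "numeral n * p \<in> nf_span B" "(numeral n :: 'k) \<noteq> 0"
  for p :: "'k::field f1_poly"
  using nf_span_prim_mult[OF prim_closed(10)[of "1 / numeral n"] that(1)]
    Const_inverse_numeral_mult[OF that(2), of p] by simp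

abbreviation "sxy \<equiv> Var Txy"
abbreviation "sx2y \<equiv> Var Tx2y"
abbreviation "sxy2 \<equiv> Var Txy2"

definition low_basis :: "'k::field f1_poly set" where
  "low_basis = {1, sxy, sx2y, sxy2, sxy ^ 2}"

definition nf_basis :: "'k::field f1_poly set" where
  "nf_basis = insert (sxy ^ 3) low_basis"

text \<open>The five relations solved for their leading products. The relation \<open>J33\<close> determines only
  \<open>a\<^sup>3 + 3bc\<close>, where \<open>a\<close>, \<open>b\<close>, \<open>c\<close> are the three variables outside \<open>prim\<close>; this is why \<open>a\<^sup>3\<close> has to
  join the basis.\<close>

lemma reductions:
  fixes p :: "'k::field f1_poly"
  assumes "(2 :: 'k) \<noteq> 0" "(3 :: 'k) \<noteq> 0"
  shows "sxy * sx2y \<in> nf_span (low_basis :: 'k f1_poly set)"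
    and "sxy * sxy2 \<in> nf_span (low_basis :: 'k f1_poly set)"
    and "sx2y ^ 2 \<in> nf_span (low_basis :: 'k f1_poly set)"
    and "sxy2 ^ 2 \<in> nf_span (low_basis :: 'k f1_poly set)"
    and "sxy ^ 3 + 3 * (sx2y * sxy2) \<in> nf_span (low_basis :: 'k f1_poly set)"
proof -
  let ?x = "Var Tx :: 'k f1_poly" let ?x2 = "Var Tx2 :: 'k f1_poly"
  let ?x3 = "Var Tx3 :: 'k f1_poly" let ?y = "Var Ty :: 'k f1_poly"
  let ?y2 = "Var Ty2 :: 'k f1_poly"
  define y3 :: "'k f1_poly" where "y3 = tilde_at Var Ty3"
  have y3: "y3 \<in> prim"
    by (auto simp: y3_def tilde_at_def intro!: prim_closed)
  have "(6 :: 'k) \<noteq> 0"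
    using assms mult_eq_0_iff[of "2 :: 'k" 3] by simp
  note divide = nf_span_divide_numeral[OF _ this] nf_span_divide_numeral[OF _ assms(2)]
  have var: "tilde_at Var (In v) = Var v" for v by (simp add: tilde_at_def)
  note J = tilde_eq poly_subst_hom var y3_def[symmetric]
  have rel: "tilde J32 \<in> nf_span B" "tilde J23 \<in> nf_span B" "tilde J42 \<in> nf_span B"
    "tilde J33 \<in> nf_span B" "tilde J24 \<in> nf_span B" for B :: "'k f1_poly set"
    by (auto simp: relations_def intro!: nf_span.ideal ideal_gen_base)
  have mem: "1 \<in> low_basis" "sxy \<in> low_basis" "sx2y \<in> low_basis" "sxy2 \<in> low_basis"
    "sxy ^ 2 \<in> (low_basis :: 'k f1_poly set)"
    by (simp_all add: low_basis_def)
  note close = nf_span.add rel nf_span.scaled nf_span_prim_mult prim_closed y3 mem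
  have "6 * (sxy * sx2y) = tilde J32
      + (3 * ?x2 - ?x^2) * sxy2 + (2 * ?x * ?y) * sx2y + (4 * ?x) * sxy ^ 2 + (- 2 * ?x^2 * ?y) * sxy
      + (3 * ?x3 * ?y2 - 4 * ?x2 * ?x * ?y2 + ?x^3 * ?y2 - ?x3 * ?y^2 + ?x2 * ?x * ?y^2) * 1"
    unfolding J32_def J by (simp add: algebra_simps)
  also have "\<dots> \<in> nf_span low_basis" by (intro close)
  finally show xy_x2y: "sxy * sx2y \<in> nf_span (low_basis :: 'k f1_poly set)" by (rule divide)
  have "6 * (sxy * sxy2) = tilde J23
      + (3 * ?y2 - ?y^2) * sx2y + (2 * ?x * ?y) * sxy2 + (4 * ?y) * sxy ^ 2 + (- 2 * ?y^2 * ?x) * sxy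
      + (3 * y3 * ?x2 - 4 * ?y2 * ?y * ?x2 + ?y^3 * ?x2 - y3 * ?x^2 + ?y2 * ?y * ?x^2) * 1"
    unfolding J23_def J by (simp add: algebra_simps)
  also have "\<dots> \<in> nf_span low_basis" by (intro close)
  finally show xy_xy2: "sxy * sxy2 \<in> nf_span (low_basis :: 'k f1_poly set)" by (rule divide)
  have "6 * sx2y ^ 2 = tilde J42 + (3 * ?x^2 - ?x2) * sxy ^ 2 + (6 * ?x3 - 2 * ?x2 * ?x) * sxy2
      + (- 4 * ?x3 * ?y + 2 * ?x2 * ?x * ?y - 2 * ?x^3 * ?y) * sxy + (4 * ?x2 * ?y) * sx2y
      + (?x2^2 * ?y2 - ?x2^2 * ?y^2 - 4 * ?x2 * ?x^2 * ?y2 + ?x2 * ?x^2 * ?y^2 + ?x^4 * ?y2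
         + 2 * ?x3 * ?x * ?y2) * 1"
    unfolding J42_def J by (simp add: algebra_simps)
  also have "\<dots> \<in> nf_span low_basis" by (intro close)
  finally show "sx2y ^ 2 \<in> nf_span (low_basis :: 'k f1_poly set)" by (rule divide)
  have "6 * sxy2 ^ 2 = tilde J24 + (3 * ?y^2 - ?y2) * sxy ^ 2 + (6 * y3 - 2 * ?y2 * ?y) * sx2y
      + (- 4 * y3 * ?x + 2 * ?y2 * ?y * ?x - 2 * ?y^3 * ?x) * sxy + (4 * ?y2 * ?x) * sxy2
      + (?y2^2 * ?x2 - ?y2^2 * ?x^2 - 4 * ?y2 * ?y^2 * ?x2 + ?y2 * ?y^2 * ?x^2 + ?y^4 * ?x2
         + 2 * y3 * ?y * ?x2) * 1"
    unfolding J24_def J by (simp add: algebra_simps)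
  also have "\<dots> \<in> nf_span low_basis" by (intro close)
  finally show "sxy2 ^ 2 \<in> nf_span (low_basis :: 'k f1_poly set)" by (rule divide)
  \<comment> \<open>the products \<open>sxy * sxy2\<close> and \<open>sxy * sx2y\<close> in \<open>J33\<close> have been reduced above\<close>
  have "sxy ^ 3 + 3 * (sx2y * sxy2) =
      tilde J33 + (- 2 * ?x) * (sxy * sxy2) + (- 2 * ?y) * (sxy * sx2y) + (5 * ?x * ?y) * sxy ^ 2
      + (?x2 * ?y2 - ?x^2 * ?y2 - ?x2 * ?y^2 - 2 * ?x^2 * ?y^2) * sxy
      + (3 * ?x2 * ?y) * sxy2 + (3 * ?x * ?y2) * sx2y
      + (3 * ?x3 * y3 - ?x2 * ?x * y3 - 3 * ?x2 * ?x * ?y2 * ?y - ?x3 * ?y2 * ?y + ?x^3 * ?y2 * ?y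
         + ?x2 * ?x * ?y^3) * 1"
    unfolding J33_def J by (simp add: algebra_simps)
  also have "\<dots> \<in> nf_span low_basis"
    by (intro close xy_x2y xy_xy2)
  finally show "sxy ^ 3 + 3 * (sx2y * sxy2) \<in> nf_span (low_basis :: 'k f1_poly set)" .
qed

lemma nf_span_diff: "p \<in> nf_span B \<Longrightarrow> q \<in> nf_span B \<Longrightarrow> p - q \<in> nf_span B"
  using nf_span.add[OF _ nf_span_prim_mult[OF prim_closed(14)[OF prim_closed(8)]], of p B q] by simp

text \<open>The span contains 1 and is closed under multiplication by the variables. The critical product is
  \<open>a\<^sup>4\<close>: it equals \<open>a(a\<^sup>3 + 3bc) - 3c(ab)\<close>, and both brackets reduce to combinations of
  \<open>1, a, b, c, a\<^sup>2\<close>, whose products with \<open>a\<close> and with \<open>c\<close> are in the span.\<close>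

lemma nf_span_nf_basis:
  assumes char: "(2 :: 'k::field) \<noteq> 0" "(3 :: 'k) \<noteq> 0"
  shows "(p :: 'k f1_poly) \<in> nf_span nf_basis"
proof -
  let ?N = "nf_span nf_basis :: 'k f1_poly set"
  note red = reductions[OF char]
  have low: "q \<in> ?N" if "q \<in> nf_span low_basis" for q
    using that by (rule nf_span_mono[rotated]) (auto simp: nf_basis_def)
  have basis: "b \<in> ?N" if "b \<in> nf_basis" for b
    using that by (rule nf_span_base)
  have cube: "sxy * sxy ^ 2 \<in> ?N"
    using basis[of "sxy ^ 3"] by (simp add: nf_basis_def power3_eq_cube power2_eq_square mult_ac)
  have sxy_low: "sxy * q \<in> ?N" if "q \<in> nf_span low_basis" for q
    using that
  proof (rule nf_span_mult_closed)
    fix b :: "'k f1_poly" assume "b \<in> low_basis"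
    then consider "b = 1" | "b = sxy" | "b = sx2y" | "b = sxy2" | "b = sxy ^ 2"
      unfolding low_basis_def by blast
    then show "sxy * b \<in> ?N"
    proof cases
      case 1 then show ?thesis using basis[of sxy] by (simp add: nf_basis_def low_basis_def)
    next
      case 2 then show ?thesis
        using basis[of "sxy ^ 2"] by (simp add: nf_basis_def low_basis_def power2_eq_square)
    qed (use red(1,2)[THEN low] cube in simp_all)
  qed
  have bc: "sx2y * sxy2 \<in> ?N"
  proof -
    have "(sxy ^ 3 + 3 * (sx2y * sxy2)) - sxy ^ 3 \<in> ?N"
      by (rule nf_span_diff[OF low[OF red(5)] basis]) (simp add: nf_basis_def)
    then show ?thesis using nf_span_divide_numeral[OF _ char(2)] by simp
  qed
  have sx2y_low: "sx2y * q \<in> ?N" if "q \<in> nf_span low_basis" for q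
    using that
  proof (rule nf_span_mult_closed)
    fix b :: "'k f1_poly" assume "b \<in> low_basis"
    then consider "b = 1" | "b = sxy" | "b = sx2y" | "b = sxy2" | "b = sxy ^ 2"
      unfolding low_basis_def by blast
    then show "sx2y * b \<in> ?N"
    proof cases
      case 1 then show ?thesis using basis[of sx2y] by (simp add: nf_basis_def low_basis_def)
    qed (use red(1,3)[THEN low] sxy_low[OF red(1)] bc in \<open>simp_all add: power2_eq_square mult_ac\<close>)
  qed
  have sxy2_low: "sxy2 * q \<in> ?N" if "q \<in> nf_span low_basis" for q
    using that
  proof (rule nf_span_mult_closed)
    fix b :: "'k f1_poly" assume "b \<in> low_basis"
    then consider "b = 1" | "b = sxy" | "b = sx2y" | "b = sxy2" | "b = sxy ^ 2"
      unfolding low_basis_def by blast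
    then show "sxy2 * b \<in> ?N"
    proof cases
      case 1 then show ?thesis using basis[of sxy2] by (simp add: nf_basis_def low_basis_def)
    qed (use red(2,4)[THEN low] sxy_low[OF red(2)] bc in \<open>simp_all add: power2_eq_square mult_ac\<close>)
  qed
  have fourth: "sxy * sxy ^ 3 \<in> ?N"
  proof -
    have "sxy * (sxy ^ 3 + 3 * (sx2y * sxy2)) - 3 * (sxy2 * (sxy * sx2y)) \<in> ?N"
      by (intro nf_span_diff sxy_low red(5) nf_span_prim_mult prim_closed sxy2_low red(1))
    then show ?thesis by (simp add: algebra_simps)
  qed
  have low_mem: "b \<in> nf_span low_basis" if "b \<in> low_basis" for b :: "'k f1_poly"
    using that by (rule nf_span_base)
  have sxy_N: "sxy * q \<in> ?N" if "q \<in> ?N" for q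
    using that by (rule nf_span_mult_closed)
      (use fourth sxy_low[OF low_mem] in \<open>auto simp: nf_basis_def\<close>)
  have "sx2y * sxy ^ 3 = (sxy * (sxy * (sxy * sx2y)) :: 'k f1_poly)"
    "sxy2 * sxy ^ 3 = (sxy * (sxy * (sxy * sxy2)) :: 'k f1_poly)"
    by (simp_all add: power3_eq_cube mult_ac)
  then have cubes: "sx2y * sxy ^ 3 \<in> ?N" "sxy2 * sxy ^ 3 \<in> ?N"
    using sxy_N[OF sxy_low[OF red(1)]] sxy_N[OF sxy_low[OF red(2)]] by (simp_all only:)
  have sx2y_N: "sx2y * q \<in> ?N" if "q \<in> ?N" for q
    using that by (rule nf_span_mult_closed)
      (use cubes sx2y_low[OF low_mem] in \<open>auto simp: nf_basis_def\<close>)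
  have sxy2_N: "sxy2 * q \<in> ?N" if "q \<in> ?N" for q
    using that by (rule nf_span_mult_closed)
      (use cubes sxy2_low[OF low_mem] in \<open>auto simp: nf_basis_def\<close>)
  have "p * q \<in> ?N" if "q \<in> ?N" for q
    using that
  proof (induction p arbitrary: q rule: mpoly_induct)
    case (Const c)
    then show ?case by (intro nf_span_prim_mult prim_closed)
  next
    case (Var v)
    then show ?case
      by (cases v) (auto intro: nf_span_prim_mult prim_closed sxy_N sx2y_N sxy2_N)
  next
    case (add p p')
    then show ?case by (simp add: distrib_right nf_span.add)
  next
    case (mult p p')
    then show ?case by (simp add: mult.assoc)
  qed
  from this[of 1] show ?thesis
    using basis[of 1] by (simp add: nf_basis_def low_basis_def)
qed

lemma nf_span_nf_basisE:
  assumes "p \<in> nf_span nf_basis"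
  obtains q0 qa qb qc qd qe where
    "q0 \<in> prim" "qa \<in> prim" "qb \<in> prim" "qc \<in> prim" "qd \<in> prim" "qe \<in> prim"
    "p - (q0 + qa * sxy + qb * sx2y + qc * sxy2 + qd * sxy ^ 2 + qe * sxy ^ 3)
       \<in> ideal_gen (set relations)"
proof -
  let ?c = "\<lambda>q0 qa qb qc qd qe. q0 + qa * sxy + qb * sx2y + qc * sxy2 + qd * sxy ^ 2 + qe * sxy ^ 3"
  have "\<exists>q0\<in>prim. \<exists>qa\<in>prim. \<exists>qb\<in>prim. \<exists>qc\<in>prim. \<exists>qd\<in>prim. \<exists>qe\<in>prim.
      p - ?c q0 qa qb qc qd qe \<in> ideal_gen (set relations)"
    using assms
  proof (induction rule: nf_span.induct)
    case (ideal p)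
    have "p - ?c 0 0 0 0 0 0 = p" by simp
    with ideal prim_closed(7) show ?case by metis
  next
    case (scaled c b)
    have "c * b = ?c c 0 0 0 0 0 \<or> c * b = ?c 0 c 0 0 0 0 \<or> c * b = ?c 0 0 c 0 0 0
        \<or> c * b = ?c 0 0 0 c 0 0 \<or> c * b = ?c 0 0 0 0 c 0 \<or> c * b = ?c 0 0 0 0 0 c"
      using scaled(2) by (auto simp: nf_basis_def low_basis_def)
    then have "c * b - ?c c 0 0 0 0 0 = 0 \<or> c * b - ?c 0 c 0 0 0 0 = 0 \<or> c * b - ?c 0 0 c 0 0 0 = 0
        \<or> c * b - ?c 0 0 0 c 0 0 = 0 \<or> c * b - ?c 0 0 0 0 c 0 = 0 \<or> c * b - ?c 0 0 0 0 0 c = 0"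
      by simp
    with scaled(1) prim_closed(7) ideal_gen_0 show ?case by metis
  next
    case (add p q)
    from add.IH(1) obtain a0 a1 a2 a3 a4 a5 where a:
        "a0 \<in> prim" "a1 \<in> prim" "a2 \<in> prim" "a3 \<in> prim" "a4 \<in> prim" "a5 \<in> prim"
        "p - ?c a0 a1 a2 a3 a4 a5 \<in> ideal_gen (set relations)"
      by blast
    from add.IH(2) obtain b0 b1 b2 b3 b4 b5 where b:
        "b0 \<in> prim" "b1 \<in> prim" "b2 \<in> prim" "b3 \<in> prim" "b4 \<in> prim" "b5 \<in> prim"
        "q - ?c b0 b1 b2 b3 b4 b5 \<in> ideal_gen (set relations)"
      by blast
    from a(7) b(7) have "(p - ?c a0 a1 a2 a3 a4 a5) + (q - ?c b0 b1 b2 b3 b4 b5) \<in> ideal_gen (set relations)"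
      by (intro ideal_gen_add)
    also have "(p - ?c a0 a1 a2 a3 a4 a5) + (q - ?c b0 b1 b2 b3 b4 b5) =
        p + q - ?c (a0 + b0) (a1 + b1) (a2 + b2) (a3 + b3) (a4 + b4) (a5 + b5)"
      by (simp add: algebra_simps)
    finally have sum: "p + q - ?c (a0 + b0) (a1 + b1) (a2 + b2) (a3 + b3) (a4 + b4) (a5 + b5)
        \<in> ideal_gen (set relations)" .
    show ?case
    proof (intro bexI)
      show "p + q - ?c (a0 + b0) (a1 + b1) (a2 + b2) (a3 + b3) (a4 + b4) (a5 + b5)
        \<in> ideal_gen (set relations)" by (rule sum)
    qed (intro prim_closed a b)+
  qed
  then show ?thesis using that by blast
qed

section \<open>Algebraic independence of the primary invariants\<close>

text \<open>Induction along the Horner scheme: the elements of the algebra are polynomials in \<open>t\<close> whose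
  coefficients lie in the algebra generated by \<open>B\<close>.\<close>

lemma alg_gen_insert_induct [consumes 1, case_names base horner]:
  assumes "p \<in> alg_gen (insert t B)"
    and base: "\<And>q. q \<in> alg_gen B \<Longrightarrow> P q"
    and horner: "\<And>q r. q \<in> alg_gen B \<Longrightarrow> P r \<Longrightarrow> P (q + t * r)"
  shows "P p"
proof -
  \<comment> \<open>the set of all Horner expressions, which turns out to be a subalgebra\<close>
  define H where "H = (\<Inter>S \<in> {S. alg_gen B \<subseteq> S \<and> (\<forall>q\<in>alg_gen B. \<forall>r\<in>S. q + t * r \<in> S)}. S)"
  have H_base: "q \<in> H" if "q \<in> alg_gen B" for q
    using that by (auto simp: H_def)
  have H_step: "q + t * r \<in> H" if "q \<in> alg_gen B" "r \<in> H" for q r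
    using that by (auto simp: H_def)
  have H_induct: "Q p" if "p \<in> H" "\<And>q. q \<in> alg_gen B \<Longrightarrow> Q q"
      "\<And>q r. q \<in> alg_gen B \<Longrightarrow> r \<in> H \<Longrightarrow> Q r \<Longrightarrow> Q (q + t * r)" for Q p
  proof -
    have "H \<subseteq> {p \<in> H. Q p}"
      using that(2,3) H_base H_step by (subst (1) H_def) (intro INT_lower, auto)
    with that(1) show ?thesis by blast
  qed
  have base_add: "c + p \<in> H" if "c \<in> alg_gen B" "p \<in> H" for c p
    using that(2)
  proof (rule H_induct)
    fix q r assume "q \<in> alg_gen B" "r \<in> H"
    then have "(c + q) + t * r \<in> H" using that(1) by (intro H_step alg_gen_add)
    then show "c + (q + t * r) \<in> H" by (simp add: add.assoc)
  qed (use that(1) in \<open>auto intro: H_base alg_gen_add\<close>)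
  have base_mult: "c * p \<in> H" if "c \<in> alg_gen B" "p \<in> H" for c p
    using that(2)
  proof (rule H_induct)
    fix q r assume "q \<in> alg_gen B" "c * r \<in> H"
    then have "c * q + t * (c * r) \<in> H" using that(1) by (intro H_step alg_gen_mult)
    then show "c * (q + t * r) \<in> H" by (simp add: algebra_simps)
  qed (use that(1) in \<open>auto intro: H_base alg_gen_mult\<close>)
  have add: "p + q \<in> H" if "p \<in> H" "q \<in> H" for p q
  proof -
    have "\<forall>q\<in>H. p + q \<in> H"
      using that(1)
    proof (rule H_induct)
      fix c r assume c: "c \<in> alg_gen B" and r: "\<forall>q\<in>H. r + q \<in> H"
      show "\<forall>q\<in>H. c + t * r + q \<in> H"
      proof
        fix q assume "q \<in> H"
        then show "c + t * r + q \<in> H"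
        proof (rule H_induct)
          fix q assume "q \<in> alg_gen B"
          then have "(c + q) + t * (r + 0) \<in> H"
            using c r H_base[OF alg_gen_0] by (intro H_step alg_gen_add) auto
          then show "c + t * r + q \<in> H" by (simp add: algebra_simps)
        next
          fix q s assume "q \<in> alg_gen B" "s \<in> H"
          then have "(c + q) + t * (r + s) \<in> H"
            using c r by (intro H_step alg_gen_add) auto
          then show "c + t * r + (q + t * s) \<in> H" by (simp add: algebra_simps)
        qed
      qed
    qed (use base_add in blast)
    with that(2) show ?thesis by blast
  qed
  have mult: "p * q \<in> H" if "p \<in> H" "q \<in> H" for p q
    using that(1)
  proof (rule H_induct)
    fix c r assume "c \<in> alg_gen B" "r * q \<in> H"
    then have "c * q + (0 + t * (r * q)) \<in> H"
      using that(2) by (intro add[OF base_mult H_step] alg_gen_0)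
    then show "(c + t * r) * q \<in> H" by (simp add: algebra_simps)
  qed (use that(2) in \<open>auto intro: base_mult\<close>)
  have "0 + t * 1 \<in> H" by (intro H_step H_base alg_gen_0 alg_gen_1)
  then have "insert t B \<subseteq> H" by (auto intro: H_base alg_gen_base)
  moreover have "subalgebra H"
    by (auto simp: subalgebra_def intro: add mult H_base alg_gen_Const)
  ultimately have "p \<in> H" using assms(1) alg_gen_minimal by blast
  then show ?thesis using base horner by (rule H_induct)
qed

text \<open>One step of a proof of algebraic independence. Suppose that a specialization \<open>h\<close> of the target kills
  the image of \<open>t\<close> but keeps the images of \<open>B\<close> independent. In a relation \<open>q + t * r\<close> the
  specialization shows that the constant term \<open>q\<close> is zero; the image of \<open>t\<close> can then be cancelled.\<close>

lemma poly_subst_inj_on_insert: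
  fixes f g :: "'v \<Rightarrow> ('w::linorder, 'k::field) mpoly"
  assumes inj: "\<And>q. q \<in> alg_gen B \<Longrightarrow> poly_subst g q = 0 \<Longrightarrow> q = 0"
    and specialize: "\<And>v. poly_subst h (f v) = g v"
    and t: "poly_subst g t = 0" "poly_subst f t \<noteq> 0"
    and p: "p \<in> alg_gen (insert t B)" "poly_subst f p = 0"
  shows "p = 0"
  using p
proof (induction p rule: alg_gen_insert_induct)
  have h: "poly_subst h (poly_subst f p) = poly_subst g p" for p
    by (simp add: poly_subst_comp specialize)
  case (base q)
  then show ?case using h[of q] inj by (simp add: poly_subst_0)
next
  have h: "poly_subst h (poly_subst f p) = poly_subst g p" for p
    by (simp add: poly_subst_comp specialize)
  case (horner q r)
  have "poly_subst g (q + t * r) = 0"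
    using h[of "q + t * r"] horner.prems by (simp add: poly_subst_0)
  then have "q = 0" using horner.hyps inj t(1) by (simp add: poly_subst_hom)
  then have "poly_subst f t * poly_subst f r = 0" using horner.prems by (simp add: poly_subst_hom)
  then have "r = 0" using t(2) horner.IH by simp
  with \<open>q = 0\<close> show ?case by simp
qed

text \<open>The coordinates are specialized one after another, so that each step kills one generator: the
  \<open>z\<^sub>i\<close> are set to zero, then \<open>x\<^sub>3 = - x\<^sub>1 - x\<^sub>2\<close> kills \<open>[x]\<close>, then \<open>x\<^sub>2 = - x\<^sub>1\<close> kills \<open>[x\<^sup>3]\<close>, and finally
  \<open>x\<^sub>1 = 0\<close> kills \<open>[x\<^sup>2]\<close>. Setting one of two \<open>z\<^sub>i\<close> to zero kills neither \<open>[z\<^sup>2]\<close> nor \<open>[z\<^sup>4]\<close>, so \<open>Ty2\<close> is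
  replaced by \<open>Ty\<^sup>2 - Ty2\<close>, whose image is twice the
  second elementary symmetric function of the \<open>z\<^sub>i\<^sup>2\<close>.\<close>

lemma phi_coord_inj_on_prim:
  assumes char: "(2 :: 'k::field) \<noteq> 0" "(3 :: 'k) \<noteq> 0"
    and p: "(p :: 'k f1_poly) \<in> prim" "phi_coord p = 0"
  shows "p = 0"
proof -
  let ?t = "Var Ty ^ 2 - Var Ty2 :: 'k f1_poly"
  let ?v = "Var :: nat \<Rightarrow> (nat, 'k) mpoly"
  note eval = poly_subst_hom poly_subst_gen_at gen_at_values
  have nz: "(2 :: (nat, 'k) mpoly) \<noteq> 0" "(3 :: (nat, 'k) mpoly) \<noteq> 0"
    using char by (simp_all add: numeral_mpoly_neq_0)
  have nonzero: "q \<noteq> 0" if "poly_subst f q \<noteq> 0" for f :: "nat \<Rightarrow> (nat, 'k) mpoly" and q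
    using that by (auto simp: poly_subst_0)
  have sum_nz: "?v 0 + ?v 1 \<noteq> 0" "?v 0 + ?v 1 + ?v 2 \<noteq> 0"
    by (rule nonzero[of "\<lambda>i. if i = 0 then ?v 0 else 0"], simp add: poly_subst_hom)+
  have step0: "q = 0" if "q \<in> alg_gen {}" "poly_subst (gen_at 0 0 0 0 0 0 :: _ \<Rightarrow> (nat, 'k) mpoly) q = 0"
    for q :: "'k f1_poly"
  proof -
    have "\<exists>c. q = Const c" using that(1)
      by (induction q rule: alg_gen_induct) (auto simp flip: Const_add Const_mult)
    then show ?thesis using that(2) by (auto simp: poly_subst_Const)
  qed
  have step1: "q = 0" if "q \<in> alg_gen {Var Tx2}"
      "poly_subst (gen_at (?v 0) (- ?v 0) 0 0 0 0) q = 0" for q :: "'k f1_poly"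
    by (rule poly_subst_inj_on_insert[where g = "gen_at 0 0 0 0 0 0"
        and h = "\<lambda>_. 0", OF step0 _ _ _ that])
       (use nz in \<open>simp_all add: eval flip: mult_2\<close>)
  have step2: "q = 0" if "q \<in> alg_gen {Var Tx3, Var Tx2}"
      "poly_subst (gen_at (?v 0) (?v 1) (- ?v 0 - ?v 1) 0 0 0) q = 0" for q :: "'k f1_poly"
  proof (rule poly_subst_inj_on_insert[where g = "gen_at (?v 0) (- ?v 0) 0 0 0 0"
        and h = "\<lambda>i. if i = 0 then ?v 0 else - ?v 0", OF step1 _ _ _ that])
    have "?v 0 ^ 3 + ?v 1 ^ 3 + (- ?v 0 - ?v 1) ^ 3 = - (3 * ?v 0 * ?v 1 * (?v 0 + ?v 1))"
      by algebra
    then show "poly_subst (gen_at (?v 0) (?v 1) (- ?v 0 - ?v 1) 0 0 0) (Var Tx3) \<noteq> 0"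
      using nz sum_nz(1) by (simp add: eval)
  qed (simp_all add: eval)
  have step3: "q = 0" if "q \<in> alg_gen {Var Tx, Var Tx3, Var Tx2}"
      "poly_subst (gen_at (?v 0) (?v 1) (?v 2) 0 0 0) q = 0" for q :: "'k f1_poly"
  proof (rule poly_subst_inj_on_insert[where g = "gen_at (?v 0) (?v 1) (- ?v 0 - ?v 1) 0 0 0"
        and h = "\<lambda>i. if i = 2 then - ?v 0 - ?v 1 else ?v i", OF step2 _ _ _ that])
    show "poly_subst (gen_at (?v 0) (?v 1) (?v 2) 0 0 0) (Var Tx) \<noteq> 0"
      using sum_nz(2) by (simp add: eval)
  qed (simp_all add: eval)
  have step4: "q = 0" if "q \<in> alg_gen {Var Ty, Var Tx, Var Tx3, Var Tx2}"
      "poly_subst (gen_at (?v 0) (?v 1) (?v 2) (?v 3) 0 0) q = 0" for q :: "'k f1_poly"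
    by (rule poly_subst_inj_on_insert[where g = "gen_at (?v 0) (?v 1) (?v 2) 0 0 0"
        and h = "\<lambda>i. if i = 3 then 0 else ?v i", OF step3 _ _ _ that])
       (simp_all add: eval)
  have step5: "q = 0" if "q \<in> alg_gen {?t, Var Ty, Var Tx, Var Tx3, Var Tx2}"
      "poly_subst (gen_at (?v 0) (?v 1) (?v 2) (?v 3) (?v 4) 0) q = 0" for q :: "'k f1_poly"
  proof (rule poly_subst_inj_on_insert[where g = "gen_at (?v 0) (?v 1) (?v 2) (?v 3) 0 0"
        and h = "\<lambda>i. if i = 4 then 0 else ?v i", OF step4 _ _ _ that])
    have "(?v 3 ^ 2 + ?v 4 ^ 2) ^ 2 - ((?v 3 ^ 2) ^ 2 + (?v 4 ^ 2) ^ 2) = 2 * ?v 3 ^ 2 * ?v 4 ^ 2"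
      by algebra
    then show "poly_subst (gen_at (?v 0) (?v 1) (?v 2) (?v 3) (?v 4) 0) ?t \<noteq> 0"
      using nz by (simp add: eval)
  qed (simp_all add: eval)
  have step6: "q = 0" if "q \<in> alg_gen {Var TS, ?t, Var Ty, Var Tx, Var Tx3, Var Tx2}"
      "poly_subst (gen_at (?v 0) (?v 1) (?v 2) (?v 3) (?v 4) (?v 5)) q = 0" for q :: "'k f1_poly"
    by (rule poly_subst_inj_on_insert[where g = "gen_at (?v 0) (?v 1) (?v 2) (?v 3) (?v 4) 0"
        and h = "\<lambda>i. if i = 5 then 0 else ?v i", OF step5 _ _ _ that])
       (simp_all add: eval)
  let ?B = "{Var TS, ?t, Var Ty, Var Tx, Var Tx3, Var Tx2}"
  have "Var Ty ^ 2 - ?t \<in> alg_gen ?B"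
    by (intro alg_gen_diff alg_gen_power alg_gen_base) simp_all
  then have "Var ` {Tx, Tx2, Tx3, Ty, Ty2, TS} \<subseteq> alg_gen ?B"
    by (auto intro: alg_gen_base)
  then have "prim \<subseteq> alg_gen ?B"
    unfolding prim_def by (rule alg_gen_minimal[OF _ subalgebra_alg_gen])
  with p show ?thesis
    by (intro step6) (auto simp: phi_coord_def)
qed

section \<open>Uniqueness of normal forms\<close>

text \<open>The functions \<open>1\<close>, \<open>a\<close>, \<open>b\<close>, \<open>c\<close>, \<open>a\<^sup>2\<close>, \<open>a\<^sup>3\<close> of the six orderings of the \<open>y\<^sub>i\<close> are linearly
  independent. The alternating sum over the orderings annihilates all but \<open>a\<^sup>3\<close>, from which it
  produces three times the product of the two Vandermonde determinants. The difference of two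
  orderings that differ by a transposition is divisible by \<open>(x\<^sub>i - x\<^sub>j)(y\<^sub>k - y\<^sub>l)\<close>; the quotients are
  affine in each of the two remaining coordinates, so that comparing them isolates the other coefficients.\<close>

lemma permuted_points_independent:
  fixes x1 x2 x3 y1 y2 y3 q0 qa qb qc qd qe :: "'r::idom"
  defines "F v1 v2 v3 \<equiv> q0 + qa * (x1 * v1 + x2 * v2 + x3 * v3)
      + qb * (x1^2 * v1 + x2^2 * v2 + x3^2 * v3) + qc * (x1 * v1^2 + x2 * v2^2 + x3 * v3^2)
      + qd * (x1 * v1 + x2 * v2 + x3 * v3)^2 + qe * (x1 * v1 + x2 * v2 + x3 * v3)^3"
  assumes F: "F y1 y2 y3 = 0" "F y2 y1 y3 = 0" "F y1 y3 y2 = 0" "F y3 y2 y1 = 0"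
      "F y2 y3 y1 = 0" "F y3 y1 y2 = 0"
    and dist: "x1 \<noteq> x2" "x1 \<noteq> x3" "x2 \<noteq> x3" "y1 \<noteq> y2" "y1 \<noteq> y3" "y2 \<noteq> y3"
    and three: "(3 :: 'r) \<noteq> 0"
  shows "q0 = 0 \<and> qa = 0 \<and> qb = 0 \<and> qc = 0 \<and> qd = 0 \<and> qe = 0"
proof -
  have "F y1 y2 y3 - F y2 y1 y3 - F y1 y3 y2 - F y3 y2 y1 + F y2 y3 y1 + F y3 y1 y2 =
      3 * ((x1 - x2) * ((x1 - x3) * ((x2 - x3) * ((y1 - y2) * ((y1 - y3) * ((y2 - y3) * qe))))))"
    unfolding F_def by algebra
  then have qe: "qe = 0" using F dist three by simp
  have cancel: "a = 0" if "(x - x') * ((y - y') * a) = u - w" "u = 0" "w = 0" "x \<noteq> x'" "y \<noteq> y'"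
    for x x' y y' a u w :: 'r
    using that by simp
  have "(x1 - x2) * ((y1 - y2) * (qa + qb * (x1 + x2) + qc * (y1 + y2)
      + qd * ((x1 + x2) * (y1 + y2) + 2 * x3 * y3))) = F y1 y2 y3 - F y2 y1 y3"
    unfolding F_def qe by algebra
  then have G33: "qa + qb * (x1 + x2) + qc * (y1 + y2)
      + qd * ((x1 + x2) * (y1 + y2) + 2 * x3 * y3) = 0"
    by (rule cancel[OF _ F(1,2) dist(1,4)])
  have "(x1 - x2) * ((y1 - y3) * (qa + qb * (x1 + x2) + qc * (y1 + y3)
      + qd * ((x1 + x2) * (y1 + y3) + 2 * x3 * y2))) = F y1 y3 y2 - F y3 y1 y2"
    unfolding F_def qe by algebra
  then have G32: "qa + qb * (x1 + x2) + qc * (y1 + y3)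
      + qd * ((x1 + x2) * (y1 + y3) + 2 * x3 * y2) = 0"
    by (rule cancel[OF _ F(3,6) dist(1,5)])
  have "(x1 - x3) * ((y1 - y2) * (qa + qb * (x1 + x3) + qc * (y1 + y2)
      + qd * ((x1 + x3) * (y1 + y2) + 2 * x2 * y3))) = F y1 y3 y2 - F y2 y3 y1"
    unfolding F_def qe by algebra
  then have G23: "qa + qb * (x1 + x3) + qc * (y1 + y2)
      + qd * ((x1 + x3) * (y1 + y2) + 2 * x2 * y3) = 0"
    by (rule cancel[OF _ F(3,5) dist(2,4)])
  have "(x1 - x3) * ((y1 - y3) * (qa + qb * (x1 + x3) + qc * (y1 + y3)
      + qd * ((x1 + x3) * (y1 + y3) + 2 * x2 * y2))) = F y1 y2 y3 - F y3 y2 y1"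
    unfolding F_def qe by algebra
  then have G22: "qa + qb * (x1 + x3) + qc * (y1 + y3)
      + qd * ((x1 + x3) * (y1 + y3) + 2 * x2 * y2) = 0"
    by (rule cancel[OF _ F(1,4) dist(2,5)])
  have "(x2 - x3) * ((y2 - y3) * (3 * qd)) = 0"
    using G33 G32 G23 G22 by algebra
  then have qd: "qd = 0" using dist three by simp
  have "qc * (y2 - y3) = 0" using G33 G32 unfolding qd by algebra
  then have qc: "qc = 0" using dist by simp
  have "qb * (x2 - x3) = 0" using G33 G23 unfolding qd by algebra
  then have qb: "qb = 0" using dist by simp
  have qa: "qa = 0" using G33 unfolding qb qc qd by simp
  have "q0 = 0" using F(1) unfolding F_def qa qb qc qd qe by simp
  with qa qb qc qd qe show ?thesis by simp
qed

text \<open>Permuting only the \<open>z\<close>-coordinates does not change the values of the coefficients, which lie in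
  \<open>prim\<close>; this gives the six equations of \<open>permuted_points_independent\<close>.\<close>

lemma phi_coord_normal_form_eq_0:
  fixes q0 qa qb qc qd qe :: "'k::field f1_poly"
  assumes char: "(2 :: 'k) \<noteq> 0" "(3 :: 'k) \<noteq> 0"
    and prim: "q0 \<in> prim" "qa \<in> prim" "qb \<in> prim" "qc \<in> prim" "qd \<in> prim" "qe \<in> prim"
    and zero: "phi_coord (q0 + qa * sxy + qb * sx2y + qc * sxy2 + qd * sxy ^ 2 + qe * sxy ^ 3) = 0"
  shows "q0 = 0 \<and> qa = 0 \<and> qb = 0 \<and> qc = 0 \<and> qd = 0 \<and> qe = 0"
proof -
  let ?v = "Var :: nat \<Rightarrow> (nat, 'k) mpoly"
  let ?ev = "\<lambda>w1 w2 w3. poly_subst (gen_at (?v 0) (?v 1) (?v 2) w1 w2 w3)"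
  let ?F = "\<lambda>v1 v2 v3. phi_coord q0 + phi_coord qa * (?v 0 * v1 + ?v 1 * v2 + ?v 2 * v3)
      + phi_coord qb * (?v 0^2 * v1 + ?v 1^2 * v2 + ?v 2^2 * v3)
      + phi_coord qc * (?v 0 * v1^2 + ?v 1 * v2^2 + ?v 2 * v3^2)
      + phi_coord qd * (?v 0 * v1 + ?v 1 * v2 + ?v 2 * v3)^2
      + phi_coord qe * (?v 0 * v1 + ?v 1 * v2 + ?v 2 * v3)^3"
  have F: "?F (w1^2) (w2^2) (w3^2) = 0"
    if sym: "w1^2 + w2^2 + w3^2 = ?v 3^2 + ?v 4^2 + ?v 5^2"
      "(w1^2)^2 + (w2^2)^2 + (w3^2)^2 = (?v 3^2)^2 + (?v 4^2)^2 + (?v 5^2)^2"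
      "w1 * w2 * w3 = ?v 3 * ?v 4 * ?v 5" for w1 w2 w3
  proof -
    have "?ev w1 w2 w3 c = phi_coord c" if "c \<in> prim" for c
      using that unfolding prim_def phi_coord_def
      by (rule poly_subst_cong_alg_gen, elim imageE insertE emptyE)
         (simp_all only: poly_subst_Var gen_at_values sym)
    moreover have "?ev w1 w2 w3 (q0 + qa * sxy + qb * sx2y + qc * sxy2 + qd * sxy ^ 2 + qe * sxy ^ 3) = 0"
      unfolding poly_subst_gen_at_eq_phi_coord[of _ _ _ w1] zero by (rule poly_subst_0)
    ultimately show ?thesis
      using prim by (simp add: poly_subst_hom gen_at_values)
  qed
  have Var_neq: "?v i \<noteq> ?v j" "?v i ^ 2 \<noteq> ?v j ^ 2" if "i \<noteq> j" for i j
  proof -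
    have "poly_subst (\<lambda>k. if k = i then ?v i else 0) (?v i ^ 2) \<noteq>
        poly_subst (\<lambda>k. if k = i then ?v i else 0) (?v j ^ 2)"
      using that by (simp add: poly_subst_hom)
    then show "?v i ^ 2 \<noteq> ?v j ^ 2" "?v i \<noteq> ?v j" by auto
  qed
  have "phi_coord q0 = 0 \<and> phi_coord qa = 0 \<and> phi_coord qb = 0 \<and> phi_coord qc = 0
      \<and> phi_coord qd = 0 \<and> phi_coord qe = 0"
    \<comment> \<open>each permutation of the \<open>z\<close>-coordinates satisfies the symmetry premises of \<open>F\<close>\<close>
    by (rule permuted_points_independent[of _ _ "?v 0" "?v 3^2" "?v 1" "?v 4^2" "?v 2" "?v 5^2"];
        (rule F)?; (rule Var_neq)?;
        (simp_all add: add_ac mult_ac numeral_mpoly_neq_0 char)?)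
  then show ?thesis
    using prim phi_coord_inj_on_prim[OF char] by blast
qed

lemma kernel_phi1:
  assumes char: "(2 :: 'k::field) \<noteq> 0" "(3 :: 'k) \<noteq> 0"
  shows "ideal_gen (set relations) = {p :: 'k f1_poly. phi1 p = 0}"
proof (intro equalityI subsetI CollectI)
  fix p :: "'k f1_poly" assume "p \<in> {p. phi1 p = 0}"
  then have p: "phi_coord p = 0" using phi1_eq_0_iff[OF char(1)] by simp
  obtain q0 qa qb qc qd qe where
    q: "q0 \<in> prim" "qa \<in> prim" "qb \<in> prim" "qc \<in> prim" "qd \<in> prim" "qe \<in> prim"
    and I: "p - (q0 + qa * sxy + qb * sx2y + qc * sxy2 + qd * sxy ^ 2 + qe * sxy ^ 3)
       \<in> ideal_gen (set relations)" (is "p - ?n \<in> _")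
    using nf_span_nf_basisE[OF nf_span_nf_basis[OF char]] by metis
  have "phi_coord (p - ?n) = 0"
    using phi1_ideal_relations[OF char(1) I] phi1_eq_0_iff[OF char(1)] by simp
  then have "phi_coord ?n = 0"
    using p by (simp add: phi_coord_def poly_subst_diff)
  with phi_coord_normal_form_eq_0[OF char q] have "?n = 0" by simp
  then show "p \<in> ideal_gen (set relations)" using I by simp
qed (rule phi1_ideal_relations[OF char(1)])

section \<open>Minimality\<close>

text \<open>A point where one relation does not vanish and the other four do separates it from the ideal that
  they generate.\<close>

lemma relation_irredundant:
  assumes char: "(2 :: 'k::field) \<noteq> 0" "(3 :: 'k) \<noteq> 0"
  defines "rs \<equiv> relations :: 'k f1_poly list"
  assumes i: "i < length rs"
  shows "rs ! i \<notin> ideal_gen ((!) rs ` ({..<length rs} - {i}))"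
proof -
  have nz: "(3 :: 'k f1_poly) \<noteq> 0" "(6 :: 'k f1_poly) \<noteq> 0" "(9 :: 'k f1_poly) \<noteq> 0"
    using char mult_eq_0_iff[of "2 :: 'k" 3] mult_eq_0_iff[of "3 :: 'k" 3]
    by (auto intro!: numeral_mpoly_neq_0)
  define g :: "f1_var set \<Rightarrow> f1_var \<Rightarrow> 'k f1_poly" where "g V v = (if v \<in> V then 1 else 0)" for V v
  note eval = poly_subst_tilde J32_def J23_def J42_def J33_def J24_def poly_subst_hom tilde_at_def g_def
  have rs_nth: "rs ! 0 = tilde J32" "rs ! Suc 0 = tilde J23" "rs ! 2 = tilde J42" "rs ! 3 = tilde J33"
    "rs ! 4 = tilde J24"
    by (simp_all add: rs_def relations_def)
  have eq: "{..<length rs} = {0, 1, 2, 3, 4}"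
    by (auto simp: rs_def relations_def)
  have separated: ?thesis
    if "poly_subst h (rs ! i) \<noteq> 0"
      "\<forall>j\<in>{0, 1, 2, 3, 4}. j \<noteq> i \<longrightarrow> poly_subst h (rs ! j) = 0" for h :: "f1_var \<Rightarrow> 'k f1_poly"
  proof
    assume "rs ! i \<in> ideal_gen ((!) rs ` ({..<length rs} - {i}))"
    then have "poly_subst h (rs ! i) = 0"
      by (rule poly_subst_ideal_gen_eq_0) (use that(2) in \<open>auto simp: eq\<close>)
    with that(1) show False ..
  qed
  from i eq have "i = 0 \<or> i = 1 \<or> i = 2 \<or> i = 3 \<or> i = 4" by blast
  then show ?thesis
  proof (elim disjE)
    assume "i = 0" then show ?thesis
      by (intro separated[of "g {Tx3, Ty2}"]) (simp_all add: rs_nth eval nz)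
  next
    assume "i = 1" then show ?thesis
      by (intro separated[of "g {Tx2, TS}"]) (simp_all add: rs_nth eval nz)
  next
    assume "i = 2" then show ?thesis
      by (intro separated[of "g {Tx2y}"]) (simp_all add: rs_nth eval nz)
  next
    assume "i = 3" then show ?thesis
      by (intro separated[of "g {Txy}"]) (simp_all add: rs_nth eval nz)
  next
    assume "i = 4" then show ?thesis
      by (intro separated[of "g {Txy2}"]) (simp_all add: rs_nth eval nz)
  qed
qed

text \<open>The relations have no constant and no linear terms, so on the coordinate axis of \<open>v\<close> they are
  divisible by the square of the coordinate.\<close>

lemma relation_quadratic:
  fixes v :: f1_var
  defines "g \<equiv> \<lambda>u. if u = v then Var 0 else (0 :: (nat, 'k::field) mpoly)"
  assumes "r \<in> set relations"
  shows "Var 0 ^ 2 dvd poly_subst g r"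
proof -
  have "(Var 0 :: (nat, 'k) mpoly) ^ 2 dvd Var 0 ^ 3" by (rule le_imp_power_dvd) simp
  moreover have "r = tilde J32 \<or> r = tilde J23 \<or> r = tilde J42 \<or> r = tilde J33 \<or> r = tilde J24"
    using assms(2) by (auto simp: relations_def)
  ultimately show ?thesis
    by (elim disjE; cases v; simp add: poly_subst_tilde J32_def J23_def J42_def J33_def J24_def
        poly_subst_hom tilde_at_def g_def)
qed

text \<open>If the generator belonging to \<open>v\<close> were a polynomial \<open>q\<close> in the others, the kernel would contain
  \<open>Var v - q\<close>, whose restriction to the axis of \<open>v\<close> is \<open>t - c\<close> with a constant \<open>c\<close>; but all elements of the
  kernel restrict to multiples of \<open>t\<^sup>2\<close>.\<close>

lemma generator_irredundant:
  assumes char: "(2 :: 'k::field) \<noteq> 0" "(3 :: 'k) \<noteq> 0"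
  shows "gen_at X1 X2 X3 Z1 Z2 Z3 v \<notin> alg_gen (gen_at X1 X2 X3 Z1 Z2 (Z3 :: 'k R_poly) ` (UNIV - {v}))"
proof
  let ?gen = "gen_at X1 X2 X3 Z1 Z2 (Z3 :: 'k R_poly)"
  assume "?gen v \<in> alg_gen (?gen ` (UNIV - {v}))"
  then have "?gen v \<in> phi1 ` alg_gen (Var ` (UNIV - {v}))"
    by (simp only: phi1_eq flip: alg_gen_image_poly_subst[of ?gen])
  then obtain q where q: "q \<in> alg_gen (Var ` (UNIV - {v}))" "?gen v = phi1 q"
    by blast
  then have "phi1 (Var v - q) = 0"
    by (simp add: phi1_eq poly_subst_hom)
  then have ideal: "Var v - q \<in> ideal_gen (set relations)"
    using kernel_phi1[OF char] by blast
  define g where "g = (\<lambda>u. if u = v then Var 0 else (0 :: (nat, 'k) mpoly))"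
  have g_v: "g v = Var 0" by (simp add: g_def)
  \<comment> \<open>on this axis all variables of \<open>q\<close> are zero\<close>
  have "\<exists>c. poly_subst g q = Const c"
    using q(1)
  proof (induction q rule: alg_gen_induct)
    case (base b)
    then have "poly_subst g b = Const 0" by (auto simp: poly_subst_Var g_def split: if_splits)
    then show ?case by blast
  next
    case (Const c)
    show ?case by (auto simp: poly_subst_Const)
  qed (auto simp: poly_subst_hom simp flip: Const_add Const_mult)
  then obtain c where c: "poly_subst g q = Const c" ..
  have "Var 0 ^ 2 dvd poly_subst g (Var v - q)"
    using ideal
  proof (induction rule: ideal_gen_induct)
    case (step b q r)
    then show ?case using relation_quadratic[of b v] by (simp add: poly_subst_hom g_def)
  qed (simp add: poly_subst_0)
  then have "Var 0 ^ 2 dvd (Var 0 - Const c :: (nat, 'k) mpoly)"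
    by (simp add: poly_subst_hom c g_v)
  then obtain h where h: "Var 0 - Const c = (Var 0 ^ 2 * h :: (nat, 'k) mpoly)" ..
  from arg_cong[OF this, of "poly_subst (\<lambda>_. 0 :: (nat, 'k) mpoly)"]
  have "c = 0" by (simp add: poly_subst_hom)
  then have "Var 0 * (1 - Var 0 * h) = (0 :: (nat, 'k) mpoly)"
    using h by (simp add: power2_eq_square algebra_simps)
  then have "1 - Var 0 * h = (0 :: (nat, 'k) mpoly)" by simp
  from arg_cong[OF this, of "poly_subst (\<lambda>_. 0 :: (nat, 'k) mpoly)"]
  show False by (simp add: poly_subst_hom)
qed

theorem corollary5:
  assumes "CHAR('k::field) = 0 \<or> CHAR('k) > 4"
  shows "minimally_generates alg_gen
           [br 1 0, br 2 0, br 3 0, br 0 2, br 0 4, br 1 2, br 2 2, br 1 4, Z1 * Z2 * Z3]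
           (R_S4 :: 'k R_poly set)
       \<and> range (phi1 :: 'k f1_poly \<Rightarrow> 'k R_poly) = R_S4
       \<and> minimally_generates ideal_gen
           [tilde J32, tilde J23, tilde J42, tilde J33, tilde J24]
           {p :: 'k f1_poly. phi1 p = 0}"
proof (intro conjI)
  have "\<not> CHAR('k) dvd 2" "\<not> CHAR('k) dvd 3"
    using assms by (auto dest: dvd_imp_le)
  then have char: "(2 :: 'k) \<noteq> 0" "(3 :: 'k) \<noteq> 0"
    using of_nat_eq_0_iff_char_dvd[of 2, where 'a = 'k] of_nat_eq_0_iff_char_dvd[of 3, where 'a = 'k]
    by simp_all
  show "range (phi1 :: 'k f1_poly \<Rightarrow> 'k R_poly) = R_S4"
    by (rule range_phi1[OF char])
  let ?gen = "gen_at X1 X2 X3 Z1 Z2 (Z3 :: 'k R_poly)"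
  let ?vs = "[Tx, Tx2, Tx3, Ty, Ty2, Txy, Tx2y, Txy2, TS]"
  have vs: "distinct ?vs" "set ?vs = UNIV"
    using f1_var.exhaust by auto
  have gens: "[br 1 0, br 2 0, br 3 0, br 0 2, br 0 4, br 1 2, br 2 2, br 1 4, Z1 * Z2 * Z3] = map ?gen ?vs"
    by (simp add: gen_at_def br_eq_psum)
  show "minimally_generates alg_gen
      [br 1 0, br 2 0, br 3 0, br 0 2, br 0 4, br 1 2, br 2 2, br 1 4, Z1 * Z2 * Z3] (R_S4 :: 'k R_poly set)"
    unfolding gens
  proof (rule minimally_generates_if_irredundant[OF alg_gen_mono])
    show gen: "alg_gen (set (map ?gen ?vs)) = R_S4"
      unfolding set_map vs(2) R_S4_eq[OF char] ..
    show "b \<in> R_S4" if "b \<in> set (map ?gen ?vs)" for b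
      using that unfolding gen[symmetric] by (rule alg_gen_base)
    fix i assume i: "i < length (map ?gen ?vs)"
    show "map ?gen ?vs ! i \<notin> alg_gen ((!) (map ?gen ?vs) ` ({..<length (map ?gen ?vs)} - {i}))"
    proof
      assume mem: "map ?gen ?vs ! i \<in> alg_gen ((!) (map ?gen ?vs) ` ({..<length (map ?gen ?vs)} - {i}))"
      have "map ?gen ?vs ! j \<in> ?gen ` (UNIV - {?vs ! i})" if "j < length ?vs" "j \<noteq> i" for j
      proof -
        have "?vs ! j \<noteq> ?vs ! i" using that i vs(1) by (subst nth_eq_iff_index_eq) auto
        then show ?thesis using that(1) by (subst nth_map) auto
      qed
      then have "(!) (map ?gen ?vs) ` ({..<length (map ?gen ?vs)} - {i}) \<subseteq> ?gen ` (UNIV - {?vs ! i})"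
        by auto
      from alg_gen_mono[OF this] mem have "?gen (?vs ! i) \<in> alg_gen (?gen ` (UNIV - {?vs ! i}))"
        using i by (subst (asm) nth_map) auto
      then show False using generator_irredundant[OF char] by blast
    qed
  qed
  show "minimally_generates ideal_gen [tilde J32, tilde J23, tilde J42, tilde J33, tilde J24]
      {p :: 'k f1_poly. phi1 p = 0}"
    unfolding relations_def[symmetric] kernel_phi1[OF char, symmetric]
    by (rule minimally_generates_if_irredundant[OF ideal_gen_mono refl])
       (use relation_irredundant[OF char] in \<open>auto intro: ideal_gen_base\<close>)
qed

end
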